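(* Let $R$ be a graded local ring, let $a\in\mathbb{Z}$, let $D$ be a degree $a$ differential $R$-module, and assume that its homology $H(D)$ is finitely generated. Let $$F_0\xleftarrow{\ \partial_{1,0}\ }F_1\xleftarrow{\ \partial_{2,1}\ }F_2\xleftarrow{\ \partial_{3,2}\ }\cdots$$ be a minimal free resolution of the $R$-module $H(D)$, twisted so that all maps are homogeneous of degree $a$ (that is, $\partial_{i,i-1}\colon F_i\to F_{i-1}(a)$, and replacing each $F_i$ by $F_i(-ia)$ and considering the same maps yields a minimal free resolution of $H(D)$ that is homogeneous of degree $0$). Then there exists a free flag resolution of $D$ whose underlying module is $\bigoplus_iF_i$ and whose differential $\partial\colon\bigoplus_iF_i\to\bigoplus_iF_i(a)$ has the following strictly upper triangular block form: the component of $\partial$ from $F_i$ to $F_j(a)$ is $0$ if $j\ge i$, it is the given map $\partial_{i,i-1}$ if $j=i-1$, and it is some homogeneous $R$-linear map $\partial_{i,j}\colon F_i\to F_j(a)$ if $j<i-1$.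
   Context: A graded local ring is an $\mathbb{N}$-graded Noetherian (not necessarily commutative) ring $R=\bigoplus_{i\ge 0}R_i$ with $R_0$ a (not necessarily commutative) local ring; $\mathfrak{m}$ denotes its maximal ideal, the sum of the maximal ideal of $R_0$ and $R_+=\bigoplus_{i>0}R_i$. All modules are graded left $R$-modules and all maps are graded (homogeneous); $D(a)$ denotes the twist with $D(a)_j=D_{a+j}$. For $a\in\mathbb{Z}$, a degree $a$ differential $R$-module is a pair $(D,\partial)$ with $D$ an $R$-module and $\partial\colon D\to D(a)$ a homogeneous $R$-linear map with $\partial^2=0$. A morphism $D\to D'$ is a homogeneous (degree-preserving) $R$-linear map $f$ with $f\partial=\partial' f$. The homology of $D$ is $H(D)=\ker(\partial\colon D\to D(a))/\operatorname{im}(\partial\colon D(-a)\to D)$. A quasi-isomorphism is a morphism inducing an isomorphism on homology. A free flag is a differential module of the form $F=\bigoplus_{i\ge 0}F_i$ where each $F_i$ is a free $R$-module and $\partial_F(F_i)\subseteq\bigoplus_{j<i}F_j(a)$ for all $i$. A free flag resolution of $D$ is a quasi-isomorphism $F\to D$ with $F$ a free flag. The minimal free resolution of the (ordinary) module $H(D)$ is the usual one: a free resolution by finitely generated graded free modules whose differentials have image in $\mathfrak{m}$ times the target. *)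

theory Defs
  imports "HOL-Algebra.Module" "HOL-Algebra.QuotRing" "HOL-Algebra.Generated_Groups"
begin

text \<open>
  The locale \<^locale>\<open>module\<close> of HOL-Algebra requires a commutative ring, so left modules over an
  arbitrary ring are introduced here, on the library's record type of modules and with
  the library's \<^locale>\<open>submodule\<close>, which makes no commutativity assumption. The fields
  \<^const>\<open>mult\<close> and \<^const>\<open>one\<close> of a module record are meaningless, as in the library.
\<close>

section \<open>Graded rings and modules\<close>

record 'r gring = "'r ring" +
  rgrade :: "nat \<Rightarrow> 'r set"

record ('r, 'm) gmodule = "('r, 'm) module" +
  grade :: "int \<Rightarrow> 'm set"

definition internal_direct_sum :: "('m, 'x) ring_scheme \<Rightarrow> ('i \<Rightarrow> 'm set) \<Rightarrow> bool" where
  "internal_direct_sum M A \<longleftrightarrow>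
     (\<forall>i. additive_subgroup (A i) M) \<and>
     (\<forall>x\<in>carrier M. \<exists>!c. (\<forall>i. c i \<in> A i) \<and> finite {i. c i \<noteq> \<zero>\<^bsub>M\<^esub>} \<and>
        x = (\<Oplus>\<^bsub>M\<^esub>i\<in>{i. c i \<noteq> \<zero>\<^bsub>M\<^esub>}. c i))"

definition left_ideal :: "'r set \<Rightarrow> ('r, 'x) ring_scheme \<Rightarrow> bool" where
  "left_ideal I R \<longleftrightarrow>
     additive_subgroup I R \<and> (\<forall>r\<in>carrier R. \<forall>x\<in>I. r \<otimes>\<^bsub>R\<^esub> x \<in> I)"

definition maximal_left_ideal :: "'r set \<Rightarrow> ('r, 'x) ring_scheme \<Rightarrow> bool" where
  "maximal_left_ideal I R \<longleftrightarrow>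
     left_ideal I R \<and> I \<noteq> carrier R \<and>
     (\<forall>J. left_ideal J R \<longrightarrow> I \<subseteq> J \<longrightarrow> J = I \<or> J = carrier R)"

locale local_ring = ring R for R (structure) +
  assumes unique_maximal_left_ideal: "\<exists>!I. maximal_left_ideal I R"

text \<open>Since all modules are left modules, Noetherian means left Noetherian.\<close>

locale left_noetherian_ring = ring R for R (structure) +
  assumes left_ideals_finitely_generated:
    "left_ideal I R \<Longrightarrow>
       \<exists>S. finite S \<and> S \<subseteq> carrier R \<and> I = \<Inter>{J. left_ideal J R \<and> S \<subseteq> J}"

locale graded_ring = ring R for R :: "'r gring" (structure) +
  assumes direct_sum: "internal_direct_sum R (rgrade R)"
    and one_homogeneous: "\<one> \<in> rgrade R 0"
    and mult_homogeneous:
      "\<lbrakk>x \<in> rgrade R i; y \<in> rgrade R j\<rbrakk> \<Longrightarrow> x \<otimes> y \<in> rgrade R (i + j)"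

definition degree_zero_part :: "'r gring \<Rightarrow> 'r gring" where
  "degree_zero_part R = R\<lparr>carrier := rgrade R 0\<rparr>"

locale graded_local_ring = graded_ring R + left_noetherian_ring R for R (structure) +
  assumes degree_zero_local: "local_ring (degree_zero_part R)"

definition irrelevant_ideal :: "'r gring \<Rightarrow> 'r set" where
  "irrelevant_ideal R = generate (add_monoid R) (\<Union>i\<in>{0<..}. rgrade R i)"

definition max_ideal :: "'r gring \<Rightarrow> 'r set" where
  "max_ideal R =
     (THE I. maximal_left_ideal I (degree_zero_part R)) <+>\<^bsub>R\<^esub> irrelevant_ideal R"

locale left_module = R?: ring R + M?: abelian_group M
  for R :: "('r, 'x) ring_scheme" (structure) and M :: "('r, 'm, 'y) module_scheme" (structure) +
  assumes smult_closed:
      "\<lbrakk>r \<in> carrier R; x \<in> carrier M\<rbrakk> \<Longrightarrow> r \<odot>\<^bsub>M\<^esub> x \<in> carrier M"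
    and smult_l_distr:
      "\<lbrakk>r \<in> carrier R; s \<in> carrier R; x \<in> carrier M\<rbrakk> \<Longrightarrow>
       (r \<oplus> s) \<odot>\<^bsub>M\<^esub> x = r \<odot>\<^bsub>M\<^esub> x \<oplus>\<^bsub>M\<^esub> s \<odot>\<^bsub>M\<^esub> x"
    and smult_r_distr:
      "\<lbrakk>r \<in> carrier R; x \<in> carrier M; y \<in> carrier M\<rbrakk> \<Longrightarrow>
       r \<odot>\<^bsub>M\<^esub> (x \<oplus>\<^bsub>M\<^esub> y) = r \<odot>\<^bsub>M\<^esub> x \<oplus>\<^bsub>M\<^esub> r \<odot>\<^bsub>M\<^esub> y"
    and smult_assoc1:
      "\<lbrakk>r \<in> carrier R; s \<in> carrier R; x \<in> carrier M\<rbrakk> \<Longrightarrow>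
       (r \<otimes> s) \<odot>\<^bsub>M\<^esub> x = r \<odot>\<^bsub>M\<^esub> (s \<odot>\<^bsub>M\<^esub> x)"
    and smult_one: "x \<in> carrier M \<Longrightarrow> \<one> \<odot>\<^bsub>M\<^esub> x = x"

locale graded_module = left_module R M
  for R :: "'r gring" (structure) and M :: "('r, 'm) gmodule" (structure) +
  assumes direct_sum: "internal_direct_sum M (grade M)"
    and smult_homogeneous:
      "\<lbrakk>r \<in> rgrade R i; x \<in> grade M j\<rbrakk> \<Longrightarrow> r \<odot>\<^bsub>M\<^esub> x \<in> grade M (int i + j)"

definition twist :: "('r, 'm) gmodule \<Rightarrow> int \<Rightarrow> ('r, 'm) gmodule" where
  "twist M a = M\<lparr>grade := \<lambda>j. grade M (a + j)\<rparr>"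

definition finitely_generated :: "'r gring \<Rightarrow> ('r, 'm) gmodule \<Rightarrow> bool" where
  "finitely_generated R M \<longleftrightarrow>
     (\<exists>S. finite S \<and> S \<subseteq> carrier M \<and> carrier M = \<Inter>{N. submodule N R M \<and> S \<subseteq> N})"

definition homogeneous_basis :: "'r gring \<Rightarrow> ('r, 'm) gmodule \<Rightarrow> 'm set \<Rightarrow> bool" where
  "homogeneous_basis R M B \<longleftrightarrow>
     B \<subseteq> (\<Union>j. grade M j) \<and>
     (\<forall>x\<in>carrier M. \<exists>!c. (\<forall>b\<in>B. c b \<in> carrier R) \<and> (\<forall>b. b \<notin> B \<longrightarrow> c b = \<zero>\<^bsub>R\<^esub>) \<and>
        finite {b. c b \<noteq> \<zero>\<^bsub>R\<^esub>} \<and>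
        x = (\<Oplus>\<^bsub>M\<^esub>b\<in>{b. c b \<noteq> \<zero>\<^bsub>R\<^esub>}. c b \<odot>\<^bsub>M\<^esub> b))"

definition graded_free :: "'r gring \<Rightarrow> ('r, 'm) gmodule \<Rightarrow> bool" where
  "graded_free R M \<longleftrightarrow> graded_module R M \<and> (\<exists>B. homogeneous_basis R M B)"

definition graded_hom ::
    "'r gring \<Rightarrow> ('r, 'm) gmodule \<Rightarrow> ('r, 'n) gmodule \<Rightarrow> ('m \<Rightarrow> 'n) \<Rightarrow> bool" where
  "graded_hom R M N f \<longleftrightarrow>
     f \<in> carrier M \<rightarrow> carrier N \<and>
     (\<forall>x\<in>carrier M. \<forall>y\<in>carrier M. f (x \<oplus>\<^bsub>M\<^esub> y) = f x \<oplus>\<^bsub>N\<^esub> f y) \<and>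
     (\<forall>r\<in>carrier R. \<forall>x\<in>carrier M. f (r \<odot>\<^bsub>M\<^esub> x) = r \<odot>\<^bsub>N\<^esub> f x) \<and>
     (\<forall>j. f ` grade M j \<subseteq> grade N j)"

text \<open>The inverse of a bijective degree-preserving map preserves degrees as well.\<close>

definition graded_iso ::
    "'r gring \<Rightarrow> ('r, 'm) gmodule \<Rightarrow> ('r, 'n) gmodule \<Rightarrow> ('m \<Rightarrow> 'n) \<Rightarrow> bool" where
  "graded_iso R M N f \<longleftrightarrow> graded_hom R M N f \<and> bij_betw f (carrier M) (carrier N)"

definition graded_submodule :: "('r, 'm) gmodule \<Rightarrow> 'm set \<Rightarrow> ('r, 'm) gmodule" where
  "graded_submodule M N = M\<lparr>carrier := N, grade := \<lambda>j. grade M j \<inter> N\<rparr>"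

text \<open>Quotient by a submodule, following the library's construction \<^const>\<open>FactRing\<close>.\<close>

definition quotient_module :: "('r, 'm) gmodule \<Rightarrow> 'm set \<Rightarrow> ('r, 'm set) gmodule" where
  "quotient_module M N =
     \<lparr>carrier = a_rcosets\<^bsub>M\<^esub> N, mult = undefined, one = undefined,
      zero = N, add = set_add M,
      smult = (\<lambda>r A. \<Union>x\<in>A. N +>\<^bsub>M\<^esub> (r \<odot>\<^bsub>M\<^esub> x)),
      grade = (\<lambda>j. (\<lambda>x. N +>\<^bsub>M\<^esub> x) ` grade M j)\<rparr>"


section \<open>Differential modules\<close>

definition diff_module :: "'r gring \<Rightarrow> int \<Rightarrow> ('r, 'm) gmodule \<Rightarrow> ('m \<Rightarrow> 'm) \<Rightarrow> bool" where
  "diff_module R a D d \<longleftrightarrow>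
     graded_module R D \<and> graded_hom R D (twist D a) d \<and>
     (\<forall>x\<in>carrier D. d (d x) = \<zero>\<^bsub>D\<^esub>)"

definition cycles :: "('r, 'm) gmodule \<Rightarrow> ('m \<Rightarrow> 'm) \<Rightarrow> ('r, 'm) gmodule" where
  "cycles D d = graded_submodule D (a_kernel D D d)"

definition boundaries :: "('r, 'm) gmodule \<Rightarrow> ('m \<Rightarrow> 'm) \<Rightarrow> 'm set" where
  "boundaries D d = d ` carrier D"

definition homology :: "('r, 'm) gmodule \<Rightarrow> ('m \<Rightarrow> 'm) \<Rightarrow> ('r, 'm set) gmodule" where
  "homology D d = quotient_module (cycles D d) (boundaries D d)"

definition diff_morphism ::
    "'r gring \<Rightarrow> ('r, 'm) gmodule \<Rightarrow> ('m \<Rightarrow> 'm) \<Rightarrow> ('r, 'n) gmodule \<Rightarrow> ('n \<Rightarrow> 'n) \<Rightarrow>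
     ('m \<Rightarrow> 'n) \<Rightarrow> bool" where
  "diff_morphism R D d D' d' f \<longleftrightarrow>
     graded_hom R D D' f \<and> (\<forall>x\<in>carrier D. f (d x) = d' (f x))"

text \<open>The induced map sends the class of a cycle \<open>x\<close> to the class of \<open>f x\<close>.\<close>

definition homology_map ::
    "('r, 'n) gmodule \<Rightarrow> ('n \<Rightarrow> 'n) \<Rightarrow> ('m \<Rightarrow> 'n) \<Rightarrow> 'm set \<Rightarrow> 'n set" where
  "homology_map D' d' f A = (\<Union>x\<in>A. boundaries D' d' +>\<^bsub>D'\<^esub> f x)"

definition quasi_isomorphism ::
    "'r gring \<Rightarrow> ('r, 'm) gmodule \<Rightarrow> ('m \<Rightarrow> 'm) \<Rightarrow> ('r, 'n) gmodule \<Rightarrow> ('n \<Rightarrow> 'n) \<Rightarrow>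
     ('m \<Rightarrow> 'n) \<Rightarrow> bool" where
  "quasi_isomorphism R D d D' d' f \<longleftrightarrow>
     diff_morphism R D d D' d' f \<and>
     graded_iso R (homology D d) (homology D' d') (homology_map D' d' f)"


section \<open>Free flags\<close>

definition direct_sum_module :: "(nat \<Rightarrow> ('r, 'm) gmodule) \<Rightarrow> ('r, nat \<Rightarrow> 'm) gmodule" where
  "direct_sum_module F =
     (let C = {x. (\<forall>i. x i \<in> carrier (F i)) \<and> finite {i. x i \<noteq> \<zero>\<^bsub>F i\<^esub>}} in
      \<lparr>carrier = C, mult = undefined, one = undefined,
       zero = (\<lambda>i. \<zero>\<^bsub>F i\<^esub>),
       add = (\<lambda>x y i. x i \<oplus>\<^bsub>F i\<^esub> y i),
       smult = (\<lambda>r x i. r \<odot>\<^bsub>F i\<^esub> x i),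
       grade = (\<lambda>j. {x \<in> C. \<forall>i. x i \<in> grade (F i) j})\<rparr>)"

definition inclusion :: "(nat \<Rightarrow> ('r, 'm) gmodule) \<Rightarrow> nat \<Rightarrow> 'm \<Rightarrow> (nat \<Rightarrow> 'm)" where
  "inclusion F i x = (\<lambda>k. if k = i then x else \<zero>\<^bsub>F k\<^esub>)"

definition block ::
    "(nat \<Rightarrow> ('r, 'm) gmodule) \<Rightarrow> ((nat \<Rightarrow> 'm) \<Rightarrow> (nat \<Rightarrow> 'm)) \<Rightarrow> nat \<Rightarrow> nat \<Rightarrow> 'm \<Rightarrow> 'm" where
  \<comment> \<open>the component from the \<open>i\<close>-th to the \<open>j\<close>-th summand\<close>
  "block F d i j x = d (inclusion F i x) j"

definition free_flag ::
    "'r gring \<Rightarrow> int \<Rightarrow> (nat \<Rightarrow> ('r, 'm) gmodule) \<Rightarrow> ((nat \<Rightarrow> 'm) \<Rightarrow> (nat \<Rightarrow> 'm)) \<Rightarrow> bool" where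
  "free_flag R a F d \<longleftrightarrow>
     (\<forall>i. graded_free R (F i)) \<and>
     diff_module R a (direct_sum_module F) d \<and>
     (\<forall>i j. i \<le> j \<longrightarrow> (\<forall>x\<in>carrier (F i). block F d i j x = \<zero>\<^bsub>F j\<^esub>))"

definition free_flag_resolution ::
    "'r gring \<Rightarrow> int \<Rightarrow> (nat \<Rightarrow> ('r, 'f) gmodule) \<Rightarrow> ((nat \<Rightarrow> 'f) \<Rightarrow> (nat \<Rightarrow> 'f)) \<Rightarrow>
     ('r, 'm) gmodule \<Rightarrow> ('m \<Rightarrow> 'm) \<Rightarrow> ((nat \<Rightarrow> 'f) \<Rightarrow> 'm) \<Rightarrow> bool" where
  "free_flag_resolution R a F dF D dD f \<longleftrightarrow>
     free_flag R a F dF \<and> quasi_isomorphism R (direct_sum_module F) dF D dD f"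


section \<open>Minimal free resolutions\<close>

text \<open>The map \<open>\<delta> i\<close> goes from \<open>F i\<close> to \<open>F (i - 1)\<close> and only matters for \<open>i \<ge> 1\<close>;
  \<open>\<epsilon>\<close> is the augmentation from \<open>F 0\<close> to \<open>M\<close>.\<close>

definition free_resolution ::
    "'r gring \<Rightarrow> ('r, 'm) gmodule \<Rightarrow> (nat \<Rightarrow> ('r, 'f) gmodule) \<Rightarrow> (nat \<Rightarrow> 'f \<Rightarrow> 'f) \<Rightarrow>
     ('f \<Rightarrow> 'm) \<Rightarrow> bool" where
  "free_resolution R M F \<delta> \<epsilon> \<longleftrightarrow>
     (\<forall>i. graded_free R (F i)) \<and>
     (\<forall>i. graded_hom R (F (Suc i)) (F i) (\<delta> (Suc i))) \<and>
     graded_hom R (F 0) M \<epsilon> \<and>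
     \<epsilon> ` carrier (F 0) = carrier M \<and>
     \<delta> 1 ` carrier (F 1) = a_kernel (F 0) M \<epsilon> \<and>
     (\<forall>i. \<delta> (Suc (Suc i)) ` carrier (F (Suc (Suc i))) =
          a_kernel (F (Suc i)) (F i) (\<delta> (Suc i)))"

definition ideal_mult_module :: "'r set \<Rightarrow> ('r, 'm) gmodule \<Rightarrow> 'm set" where
  "ideal_mult_module I M =
     generate (add_monoid M) {r \<odot>\<^bsub>M\<^esub> x | r x. r \<in> I \<and> x \<in> carrier M}"

definition minimal_free_resolution ::
    "'r gring \<Rightarrow> ('r, 'm) gmodule \<Rightarrow> (nat \<Rightarrow> ('r, 'f) gmodule) \<Rightarrow> (nat \<Rightarrow> 'f \<Rightarrow> 'f) \<Rightarrow>
     ('f \<Rightarrow> 'm) \<Rightarrow> bool" where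
  "minimal_free_resolution R M F \<delta> \<epsilon> \<longleftrightarrow>
     free_resolution R M F \<delta> \<epsilon> \<and>
     (\<forall>i. finitely_generated R (F i)) \<and>
     (\<forall>i. \<delta> (Suc i) ` carrier (F (Suc i)) \<subseteq> ideal_mult_module (max_ideal R) (F i))"

end

theory Submission
  imports Defs
begin

text \<open>
  The flag is built one summand at a time, as a perturbation of the resolution. On \<open>F 0\<close> the
  differential is zero, and \<open>f\<close> lifts the augmentation \<open>\<epsilon>\<close> from homology classes to cycles of \<open>D\<close>.
  Suppose that a differential \<open>d\<close> with leading term \<open>\<delta>\<close> and a chain map \<open>f\<close> to \<open>D\<close> are already
  defined on \<open>F 0 \<oplus> \<dots> \<oplus> F n\<close>. Exactness of the resolution has two consequences.

  First (lemma \<open>bounds_if_image_bounds\<close>), a cycle \<open>u\<close> supported below \<open>m \<le> n\<close> whose image \<open>f u\<close>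
  bounds in \<open>D\<close> is itself a boundary: the leading term of \<open>u\<close> is killed by \<open>\<delta>\<close>, or by \<open>\<epsilon>\<close> at the
  bottom, hence has the form \<open>\<delta> v\<close>; subtracting \<open>d v\<close> from \<open>u\<close> shortens its support.

  Second (lemma \<open>cycle_lifting\<close>), every \<open>z\<close> in the image of \<open>\<delta> (n + 1)\<close> is the leading term of a
  cycle \<open>u\<close> such that \<open>f u\<close> bounds. As \<open>\<delta> n\<close> kills \<open>z\<close>, the element \<open>d z\<close> lies two summands below
  \<open>z\<close>, and \<open>f (d z)\<close> bounds, so by the first fact \<open>d z = d w\<close> for some \<open>w\<close> below \<open>z\<close>. The homology
  class of \<open>f (z - w)\<close> is \<open>\<epsilon> t\<close> for some \<open>t\<close> in \<open>F 0\<close>, and \<open>u = z - w - t\<close> is the desired cycle.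

  For an element \<open>b\<close> of a homogeneous basis of \<open>F (n + 1)\<close> the second fact, applied to \<open>\<delta> b\<close>,
  gives a cycle \<open>u\<close> with leading term \<open>\<delta> b\<close> and an element \<open>y\<close> with \<open>f u = dD y\<close>; both can be
  made homogeneous by passing to homogeneous components. Setting \<open>d b = u\<close> and \<open>f b = y\<close> and
  extending linearly (lemma \<open>extend_from_basis\<close>) defines \<open>d\<close> and \<open>f\<close> on the next summand. In the
  limit, \<open>f\<close> is onto in homology because already \<open>\<epsilon>\<close> is, and it is injective in homology by the
  first fact.
\<close>

section \<open>Homomorphisms and sums in abelian groups\<close>

lemma abelian_group_hom_of_additive:
  assumes "abelian_group G" "abelian_group H" "h \<in> carrier G \<rightarrow> carrier H"
    and "\<And>x y. \<lbrakk>x \<in> carrier G; y \<in> carrier G\<rbrakk> \<Longrightarrow> h (x \<oplus>\<^bsub>G\<^esub> y) = h x \<oplus>\<^bsub>H\<^esub> h y"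
  shows "abelian_group_hom G H h"
proof -
  interpret G: abelian_group G by fact
  interpret H: abelian_group H by fact
  show ?thesis
    using assms(3,4)
    by (auto intro!: abelian_group_homI G.abelian_group_axioms H.abelian_group_axioms
        group_hom.intro group_hom_axioms.intro G.a_group H.a_group simp: hom_def)
qed

lemma (in abelian_group_hom) hom_finsum:
  assumes "g \<in> I \<rightarrow> carrier G"
  shows "h (\<Oplus>\<^bsub>G\<^esub>i\<in>I. g i) = (\<Oplus>\<^bsub>H\<^esub>i\<in>I. h (g i))"
  using assms
proof (induction I rule: infinite_finite_induct)
  case (insert i I)
  then have "g i \<in> carrier G" "g \<in> I \<rightarrow> carrier G" "(\<lambda>i. h (g i)) \<in> I \<rightarrow> carrier H"
    by (auto intro: hom_closed)
  with insert show ?case by (simp add: G.finsum_insert H.finsum_insert)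
qed (auto simp: G.finsum_infinite H.finsum_infinite)

lemma (in abelian_group) finsum_mem:
  assumes "\<zero> \<in> P" "\<And>x y. \<lbrakk>x \<in> P; y \<in> P\<rbrakk> \<Longrightarrow> x \<oplus> y \<in> P" "P \<subseteq> carrier G"
    and "\<And>i. i \<in> I \<Longrightarrow> g i \<in> P"
  shows "(\<Oplus>i\<in>I. g i) \<in> P"
  using assms(4)
proof (induction I rule: infinite_finite_induct)
  case (insert i I)
  then have "g i \<in> carrier G" "g \<in> I \<rightarrow> carrier G"
    using assms(3) by auto
  with insert show ?case by (simp add: finsum_insert assms)
qed (auto simp: finsum_infinite assms)

lemma (in abelian_group) finsum_superset:
  assumes "finite J" "I \<subseteq> J" "g \<in> J \<rightarrow> carrier G" "\<And>i. i \<in> J - I \<Longrightarrow> g i = \<zero>"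
  shows "(\<Oplus>i\<in>I. g i) = (\<Oplus>i\<in>J. g i)"
  using assms by (intro add.finprod_mono_neutral_cong_left) auto

lemma (in abelian_group) minus_cancel_right:
  assumes "x \<in> carrier G" "y \<in> carrier G"
  shows "x \<ominus> y \<oplus> y = x"
  using assms by (simp add: minus_eq a_assoc l_neg)

lemma (in abelian_group) diff_zero:
  assumes "x \<in> carrier G"
  shows "x \<ominus> \<zero> = x"
  using minus_cancel_right[OF assms zero_closed] assms by simp

section \<open>Homogeneous components\<close>

definition component :: "('m, 'x) ring_scheme \<Rightarrow> ('i \<Rightarrow> 'm set) \<Rightarrow> 'm \<Rightarrow> 'i \<Rightarrow> 'm" where
  "component M A x = (THE c. (\<forall>i. c i \<in> A i) \<and> finite {i. c i \<noteq> \<zero>\<^bsub>M\<^esub>} \<and>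
     x = (\<Oplus>\<^bsub>M\<^esub>i\<in>{i. c i \<noteq> \<zero>\<^bsub>M\<^esub>}. c i))"

locale internal_sum = abelian_group M for M (structure) +
  fixes A :: "'i \<Rightarrow> _ set"
  assumes direct: "internal_direct_sum M A"
begin

lemma summand_subgroup: "additive_subgroup (A i) M"
  using direct by (simp add: internal_direct_sum_def)

lemma summand_closed: "x \<in> A i \<Longrightarrow> x \<in> carrier M"
  using additive_subgroup.a_subset[OF summand_subgroup] by auto

lemma zero_in_summand: "\<zero> \<in> A i"
  using additive_subgroup.zero_closed[OF summand_subgroup] .

lemma component_decomposition:
  assumes "x \<in> carrier M"
  shows "component M A x i \<in> A i" "finite {i. component M A x i \<noteq> \<zero>}"
    and "x = (\<Oplus>i\<in>{i. component M A x i \<noteq> \<zero>}. component M A x i)"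
proof -
  have "\<exists>!c. (\<forall>i. c i \<in> A i) \<and> finite {i. c i \<noteq> \<zero>} \<and> x = (\<Oplus>i\<in>{i. c i \<noteq> \<zero>}. c i)"
    using direct assms by (simp add: internal_direct_sum_def)
  from theI'[OF this]
  show "component M A x i \<in> A i" "finite {i. component M A x i \<noteq> \<zero>}"
    and "x = (\<Oplus>i\<in>{i. component M A x i \<noteq> \<zero>}. component M A x i)"
    unfolding component_def[symmetric] by auto
qed

lemma component_closed: "x \<in> carrier M \<Longrightarrow> component M A x i \<in> carrier M"
  using component_decomposition(1) summand_closed by blast

lemma component_eqI:
  assumes fin: "finite I" and c: "\<And>i. c i \<in> A i" and out: "\<And>i. i \<notin> I \<Longrightarrow> c i = \<zero>"
    and x: "x = (\<Oplus>i\<in>I. c i)"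
  shows "component M A x = c"
proof -
  have x_closed: "x \<in> carrier M"
    unfolding x using c summand_closed by (intro finsum_closed) auto
  have sub: "{i. c i \<noteq> \<zero>} \<subseteq> I" using out by blast
  have "finite {i. c i \<noteq> \<zero>}" using fin sub finite_subset by blast
  moreover have "x = (\<Oplus>i\<in>{i. c i \<noteq> \<zero>}. c i)"
    unfolding x using c summand_closed by (intro finsum_superset[symmetric] fin sub) auto
  moreover have "\<exists>!c. (\<forall>i. c i \<in> A i) \<and> finite {i. c i \<noteq> \<zero>} \<and> x = (\<Oplus>i\<in>{i. c i \<noteq> \<zero>}. c i)"
    using direct x_closed by (simp add: internal_direct_sum_def)
  ultimately show ?thesis
    unfolding component_def using c by (intro the1_equality) auto
qed

lemma component_of_summand:
  assumes "x \<in> A k"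
  shows "component M A x i = (if i = k then x else \<zero>)"
proof -
  have "x = (\<Oplus>i\<in>{k}. if i = k then x else \<zero>)"
    using assms summand_closed[OF assms] by (simp add: finsum_insert)
  then have "component M A x = (\<lambda>i. if i = k then x else \<zero>)"
    using assms zero_in_summand by (intro component_eqI[where I = "{k}"]) auto
  then show ?thesis by simp
qed

lemma component_zero: "component M A \<zero> i = \<zero>"
  using component_of_summand[OF zero_in_summand] by auto

lemma component_add:
  assumes "x \<in> carrier M" "y \<in> carrier M"
  shows "component M A (x \<oplus> y) i = component M A x i \<oplus> component M A y i"
proof -
  let ?I = "{i. component M A x i \<noteq> \<zero>} \<union> {i. component M A y i \<noteq> \<zero>}"
  have fin: "finite ?I" using component_decomposition(2) assms by simp
  have "x = (\<Oplus>i\<in>?I. component M A x i)"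
    by (subst component_decomposition(3)[OF assms(1)])
      (use assms component_closed fin in \<open>intro finsum_superset; auto\<close>)
  moreover have "y = (\<Oplus>i\<in>?I. component M A y i)"
    by (subst component_decomposition(3)[OF assms(2)])
      (use assms component_closed fin in \<open>intro finsum_superset; auto\<close>)
  ultimately have "x \<oplus> y = (\<Oplus>i\<in>?I. component M A x i) \<oplus> (\<Oplus>i\<in>?I. component M A y i)"
    by simp
  also have "\<dots> = (\<Oplus>i\<in>?I. component M A x i \<oplus> component M A y i)"
    using assms component_closed by (intro finsum_addf[symmetric]) auto
  finally have "component M A (x \<oplus> y) = (\<lambda>i. component M A x i \<oplus> component M A y i)"
    using component_decomposition(1) assms additive_subgroup.a_closed[OF summand_subgroup] fin
    by (intro component_eqI[where I = ?I]) auto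
  then show ?thesis by simp
qed

end

text \<open>
  Taking components is natural. The index shift \<open>s\<close> makes the statement applicable to maps that
  change degrees.
\<close>

lemma component_hom:
  assumes "internal_sum M A" "internal_sum N B" "abelian_group_hom M N f"
    and inj: "inj s" and deg: "\<And>i. f ` A i \<subseteq> B (s i)" and x: "x \<in> carrier M"
  shows "component N B (f x) (s i) = f (component M A x i)"
proof -
  interpret M: internal_sum M A by fact
  interpret N: internal_sum N B by fact
  interpret f: abelian_group_hom M N f by fact
  define I where "I = {i. component M A x i \<noteq> \<zero>\<^bsub>M\<^esub>}"
  define c where "c k = (if k \<in> range s then f (component M A x (inv_into UNIV s k)) else \<zero>\<^bsub>N\<^esub>)" for k
  have cs: "c (s i) = f (component M A x i)" for i
    using inj by (simp add: c_def)
  have fin: "finite I" using M.component_decomposition(2)[OF x] by (simp add: I_def)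
  have "f x = f (\<Oplus>\<^bsub>M\<^esub>i\<in>I. component M A x i)"
    using M.component_decomposition(3)[OF x] by (simp add: I_def)
  also have "\<dots> = (\<Oplus>\<^bsub>N\<^esub>i\<in>I. f (component M A x i))"
    using M.component_closed[OF x] by (intro f.hom_finsum) auto
  also have "\<dots> = (\<Oplus>\<^bsub>N\<^esub>i\<in>I. c (s i))"
    by (simp add: cs)
  also have "\<dots> = (\<Oplus>\<^bsub>N\<^esub>k\<in>s ` I. c k)"
    using inj M.component_closed[OF x]
    by (intro N.finsum_reindex[symmetric]) (auto simp: cs intro: inj_on_subset)
  finally have "component N B (f x) = c"
  proof (intro N.component_eqI[where I = "s ` I"])
    show "c k \<in> B k" for k
      using deg M.component_decomposition(1)[OF x] N.zero_in_summand
      by (cases "k \<in> range s") (auto simp: cs, auto simp: c_def)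
    show "c k = \<zero>\<^bsub>N\<^esub>" if "k \<notin> s ` I" for k
      using that by (cases "k \<in> range s") (auto simp: cs I_def, auto simp: c_def)
  qed (use fin in auto)
  then show ?thesis by (simp add: cs)
qed

text \<open>
  A direct sum decomposition can be given by its projections: if \<open>x\<close> is any finite sum of elements
  \<open>c i\<close> of the summands, applying the \<open>k\<close>-th projection recovers \<open>c k\<close>, which gives uniqueness.
\<close>

lemma (in abelian_group) internal_direct_sumI:
  assumes sub: "\<And>i. additive_subgroup (A i) G"
    and hom: "\<And>i. abelian_group_hom G G (p i)"
    and mem: "\<And>x i. x \<in> carrier G \<Longrightarrow> p i x \<in> A i"
    and fin: "\<And>x. x \<in> carrier G \<Longrightarrow> finite {i. p i x \<noteq> \<zero>}"
    and sum: "\<And>x. x \<in> carrier G \<Longrightarrow> x = (\<Oplus>i\<in>{i. p i x \<noteq> \<zero>}. p i x)"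
    and proj: "\<And>x i k. x \<in> A k \<Longrightarrow> p i x = (if i = k then x else \<zero>)"
  shows "internal_direct_sum G A"
  unfolding internal_direct_sum_def
proof (intro conjI allI ballI ex1I)
  fix x assume x: "x \<in> carrier G"
  show "p i x \<in> A i" "finite {i. p i x \<noteq> \<zero>}" "x = (\<Oplus>i\<in>{i. p i x \<noteq> \<zero>}. p i x)" for i
    using mem fin sum x by auto
  fix c assume c: "(\<forall>i. c i \<in> A i) \<and> finite {i. c i \<noteq> \<zero>} \<and> x = (\<Oplus>i\<in>{i. c i \<noteq> \<zero>}. c i)"
  show "c = (\<lambda>i. p i x)"
  proof
    fix k
    interpret p: abelian_group_hom G G "p k" by (rule hom)
    have cc: "c i \<in> carrier G" for i
      using c additive_subgroup.a_subset[OF sub] by auto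
    have "p k x = (\<Oplus>i\<in>{i. c i \<noteq> \<zero>}. p k (c i))"
      using c cc p.hom_finsum[of c "{i. c i \<noteq> \<zero>}"] by auto
    also have "\<dots> = (\<Oplus>i\<in>{i. c i \<noteq> \<zero>}. if k = i then c i else \<zero>)"
      using c cc proj by (intro finsum_cong') auto
    also have "\<dots> = c k"
    proof (cases "c k = \<zero>")
      case True
      then have "(\<Oplus>i\<in>{i. c i \<noteq> \<zero>}. if k = i then c i else \<zero>) = (\<Oplus>i\<in>{i. c i \<noteq> \<zero>}. \<zero>)"
        by (intro finsum_cong') auto
      with True show ?thesis by (simp add: finsum_zero)
    next
      case False
      then show ?thesis
        using c cc by (intro finsum_singleton) auto
    qed
    finally show "c k = p k x" by simp
  qed
qed (rule sub)

section \<open>Graded modules\<close>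

lemma add_monoid_twist [simp]: "add_monoid (twist M a) = add_monoid M"
  by (simp add: twist_def)

lemma twist_simps [simp]:
  "carrier (twist M a) = carrier M" "zero (twist M a) = zero M" "add (twist M a) = add M"
  "smult (twist M a) = smult M" "grade (twist M a) j = grade M (a + j)"
  "finsum (twist M a) = finsum M" "a_inv (twist M a) = a_inv M"
  "twist (twist M a) b = twist M (a + b)" "twist M 0 = M"
  by (auto simp: twist_def finsum_def a_inv_def add.assoc fun_eq_iff)

lemma abelian_group_twist: "abelian_group (twist M a) = abelian_group M"
  by (simp add: abelian_group_def abelian_monoid_def abelian_group_axioms_def)

lemma additive_subgroup_twist: "additive_subgroup H (twist M a) = additive_subgroup H M"
  by (simp add: additive_subgroup_def)

lemma internal_direct_sum_twist: "internal_direct_sum (twist M a) A = internal_direct_sum M A"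
  by (simp add: internal_direct_sum_def additive_subgroup_twist)

sublocale graded_module \<subseteq> internal_sum M "grade M"
  by (unfold_locales) (rule direct_sum)

abbreviation homogeneous_part :: "('r, 'm) gmodule \<Rightarrow> int \<Rightarrow> 'm \<Rightarrow> 'm" where
  "homogeneous_part M j x \<equiv> component M (grade M) x j"

lemma (in graded_module) grade_unique:
  assumes "x \<noteq> \<zero>\<^bsub>M\<^esub>" "x \<in> grade M i" "x \<in> grade M j"
  shows "i = j"
  using component_of_summand[OF assms(2), of i] component_of_summand[OF assms(3), of i] assms(1)
  by (auto split: if_splits)

lemma (in graded_module) homogeneous_part_hom:
  "abelian_group_hom M M (homogeneous_part M j)"
  by (intro abelian_group_hom_of_additive M.abelian_group_axioms) (auto simp: component_closed component_add)

lemma (in graded_module) graded_module_twist: "graded_module R (twist M a)"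
proof -
  have "internal_direct_sum M (\<lambda>j. grade M (a + j))"
  proof (rule internal_direct_sumI[where p = "\<lambda>j. homogeneous_part M (a + j)"])
    fix x assume x: "x \<in> carrier M"
    let ?S = "{j. homogeneous_part M (a + j) x \<noteq> \<zero>\<^bsub>M\<^esub>}"
    have S: "(+) a ` ?S = {j. homogeneous_part M j x \<noteq> \<zero>\<^bsub>M\<^esub>}"
      by (force simp: image_iff intro: exI[of _ "_ - a"])
    show "finite ?S"
      using component_decomposition(2)[OF x] unfolding S[symmetric]
      by (rule finite_imageD) (auto simp: inj_on_def)
    show "x = (\<Oplus>\<^bsub>M\<^esub>j\<in>?S. homogeneous_part M (a + j) x)"
      using component_decomposition(3)[OF x] component_closed[OF x] unfolding S[symmetric]
      by (subst (asm) finsum_reindex) (auto simp: inj_on_def)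
  qed (use summand_subgroup homogeneous_part_hom component_decomposition(1)
       in \<open>auto simp: component_of_summand\<close>)
  moreover have "grade (twist M a) = (\<lambda>j. grade M (a + j))" by auto
  moreover have "r \<odot>\<^bsub>M\<^esub> x \<in> grade M (a + (int i + j))"
    if "r \<in> rgrade R i" "x \<in> grade M (a + j)" for r i x j
    using smult_homogeneous[OF that] by (simp add: add.left_commute)
  ultimately show ?thesis
    unfolding graded_module_def graded_module_axioms_def left_module_def left_module_axioms_def
      abelian_group_twist internal_direct_sum_twist
    using R.ring_axioms M.abelian_group_axioms smult_closed smult_l_distr smult_r_distr
      smult_assoc1 smult_one smult_homogeneous
    by auto
qed

lemma (in left_module) smult_left_hom:
  "r \<in> carrier R \<Longrightarrow> abelian_group_hom M M (\<lambda>x. r \<odot>\<^bsub>M\<^esub> x)"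
  by (intro abelian_group_hom_of_additive M.abelian_group_axioms) (auto simp: smult_closed smult_r_distr)

lemma (in left_module) smult_right_hom:
  "x \<in> carrier M \<Longrightarrow> abelian_group_hom R M (\<lambda>r. r \<odot>\<^bsub>M\<^esub> x)"
  by (intro abelian_group_hom_of_additive M.abelian_group_axioms R.abelian_group_axioms)
    (auto simp: smult_closed smult_l_distr)

lemma (in left_module) smult_zeros [simp]:
  "r \<in> carrier R \<Longrightarrow> r \<odot>\<^bsub>M\<^esub> \<zero>\<^bsub>M\<^esub> = \<zero>\<^bsub>M\<^esub>"
  "x \<in> carrier M \<Longrightarrow> \<zero> \<odot>\<^bsub>M\<^esub> x = \<zero>\<^bsub>M\<^esub>"
  using abelian_group_hom.hom_zero[OF smult_left_hom] abelian_group_hom.hom_zero[OF smult_right_hom]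
  by auto

lemma graded_homD:
  assumes "graded_hom R M N f"
  shows "x \<in> carrier M \<Longrightarrow> f x \<in> carrier N"
    and "\<lbrakk>x \<in> carrier M; y \<in> carrier M\<rbrakk> \<Longrightarrow> f (x \<oplus>\<^bsub>M\<^esub> y) = f x \<oplus>\<^bsub>N\<^esub> f y"
    and "\<lbrakk>r \<in> carrier R; x \<in> carrier M\<rbrakk> \<Longrightarrow> f (r \<odot>\<^bsub>M\<^esub> x) = r \<odot>\<^bsub>N\<^esub> f x"
    and "x \<in> grade M j \<Longrightarrow> f x \<in> grade N j"
  using assms unfolding graded_hom_def by blast+

text \<open>
  Maps of degree \<open>a\<close> are graded homomorphisms into a twist; the twist is invisible to the
  underlying groups, and \<open>a = 0\<close> covers degree-preserving maps.
\<close>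

lemma graded_hom_abelian:
  assumes "abelian_group M" "abelian_group N" "graded_hom R M (twist N a) f"
  shows "abelian_group_hom M N f"
  using graded_homD[OF assms(3)] assms(1,2) by (intro abelian_group_hom_of_additive) auto

lemma homogeneous_part_hom_commute:
  assumes "graded_module R M" "graded_module R N" "graded_hom R M (twist N a) f" "x \<in> carrier M"
  shows "homogeneous_part N (a + j) (f x) = f (homogeneous_part M j x)"
proof -
  interpret M: graded_module R M by fact
  interpret N: graded_module R N by fact
  show ?thesis
    by (rule component_hom[where s = "(+) a", OF M.internal_sum_axioms N.internal_sum_axioms])
      (use assms graded_homD[OF assms(3)] in
        \<open>auto intro: graded_hom_abelian M.M.abelian_group_axioms N.M.abelian_group_axioms\<close>)
qed

section \<open>Maps out of graded free modules\<close>

lemma graded_free_twist: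
  assumes "graded_free R M"
  shows "graded_free R (twist M a)"
proof -
  have "(\<Union>j. grade (twist M a) j) = (\<Union>j. grade M j)"
  proof -
    have "grade M j = grade (twist M a) (j - a)" for j by simp
    then show ?thesis by (auto simp del: twist_simps(5)) (auto simp: twist_simps(5))
  qed
  then have "homogeneous_basis R (twist M a) B = homogeneous_basis R M B" for B
    by (simp add: homogeneous_basis_def)
  then show ?thesis
    using assms graded_module.graded_module_twist by (auto simp: graded_free_def)
qed

definition coordinates :: "'r gring \<Rightarrow> ('r, 'm) gmodule \<Rightarrow> 'm set \<Rightarrow> 'm \<Rightarrow> 'm \<Rightarrow> 'r" where
  "coordinates R M B x = (THE c. (\<forall>b\<in>B. c b \<in> carrier R) \<and> (\<forall>b. b \<notin> B \<longrightarrow> c b = \<zero>\<^bsub>R\<^esub>) \<and>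
     finite {b. c b \<noteq> \<zero>\<^bsub>R\<^esub>} \<and> x = (\<Oplus>\<^bsub>M\<^esub>b\<in>{b. c b \<noteq> \<zero>\<^bsub>R\<^esub>}. c b \<odot>\<^bsub>M\<^esub> b))"

locale based_module = graded_module R M for R (structure) and M (structure) +
  fixes B
  assumes basis: "homogeneous_basis R M B"
begin

lemma basis_homogeneous: "b \<in> B \<Longrightarrow> \<exists>j. b \<in> grade M j"
  using basis by (auto simp: homogeneous_basis_def)

lemma basis_closed: "b \<in> B \<Longrightarrow> b \<in> carrier M"
  using basis_homogeneous summand_closed by blast

lemma coordinates_props:
  assumes "x \<in> carrier M"
  shows "coordinates R M B x b \<in> carrier R" "b \<notin> B \<Longrightarrow> coordinates R M B x b = \<zero>"
    and "finite {b. coordinates R M B x b \<noteq> \<zero>}"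
    and "x = (\<Oplus>\<^bsub>M\<^esub>b\<in>{b. coordinates R M B x b \<noteq> \<zero>}. coordinates R M B x b \<odot>\<^bsub>M\<^esub> b)"
proof -
  have "\<exists>!c. (\<forall>b\<in>B. c b \<in> carrier R) \<and> (\<forall>b. b \<notin> B \<longrightarrow> c b = \<zero>) \<and>
     finite {b. c b \<noteq> \<zero>} \<and> x = (\<Oplus>\<^bsub>M\<^esub>b\<in>{b. c b \<noteq> \<zero>}. c b \<odot>\<^bsub>M\<^esub> b)"
    using basis assms by (simp add: homogeneous_basis_def)
  note c = theI'[OF this, folded coordinates_def]
  show "coordinates R M B x b \<in> carrier R" using c by (cases "b \<in> B") auto
  show "b \<notin> B \<Longrightarrow> coordinates R M B x b = \<zero>" using c by auto
  show "finite {b. coordinates R M B x b \<noteq> \<zero>}"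
    and "x = (\<Oplus>\<^bsub>M\<^esub>b\<in>{b. coordinates R M B x b \<noteq> \<zero>}. coordinates R M B x b \<odot>\<^bsub>M\<^esub> b)"
    using c by auto
qed

lemma coordinates_support: "x \<in> carrier M \<Longrightarrow> {b. coordinates R M B x b \<noteq> \<zero>} \<subseteq> B"
  using coordinates_props(2) by blast

lemma coordinates_expansion:
  assumes x: "x \<in> carrier M" and I: "finite I" "I \<subseteq> B"
    and out: "\<And>b. b \<notin> I \<Longrightarrow> coordinates R M B x b = \<zero>"
  shows "x = (\<Oplus>\<^bsub>M\<^esub>b\<in>I. coordinates R M B x b \<odot>\<^bsub>M\<^esub> b)"
proof -
  have cl: "coordinates R M B x b \<odot>\<^bsub>M\<^esub> b \<in> carrier M" if "b \<in> I" for b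
    using that I(2) by (intro smult_closed coordinates_props(1) x basis_closed) auto
  have "(\<Oplus>\<^bsub>M\<^esub>b\<in>{b. coordinates R M B x b \<noteq> \<zero>}. coordinates R M B x b \<odot>\<^bsub>M\<^esub> b)
      = (\<Oplus>\<^bsub>M\<^esub>b\<in>I. coordinates R M B x b \<odot>\<^bsub>M\<^esub> b)"
    using I cl basis_closed by (intro M.finsum_superset I) (auto intro: out)
  then show ?thesis using coordinates_props(4)[OF x] by simp
qed

lemma coordinates_eqI:
  assumes fin: "finite I" "I \<subseteq> B" and c: "\<And>b. b \<in> B \<Longrightarrow> c b \<in> carrier R"
    and out: "\<And>b. b \<notin> I \<Longrightarrow> c b = \<zero>"
    and x: "x = (\<Oplus>\<^bsub>M\<^esub>b\<in>I. c b \<odot>\<^bsub>M\<^esub> b)"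
  shows "coordinates R M B x = c"
proof -
  have cl: "c b \<odot>\<^bsub>M\<^esub> b \<in> carrier M" if "b \<in> I" for b
    using that fin c basis_closed smult_closed by auto
  have x_closed: "x \<in> carrier M"
    unfolding x using cl by (intro M.finsum_closed) auto
  have sub: "{b. c b \<noteq> \<zero>} \<subseteq> I" using out by blast
  have "finite {b. c b \<noteq> \<zero>}" using fin(1) sub finite_subset by blast
  moreover have "x = (\<Oplus>\<^bsub>M\<^esub>b\<in>{b. c b \<noteq> \<zero>}. c b \<odot>\<^bsub>M\<^esub> b)"
    unfolding x using cl fin basis_closed
    by (intro M.finsum_superset[symmetric] fin sub) (auto simp: subset_iff)
  moreover have "\<exists>!c. (\<forall>b\<in>B. c b \<in> carrier R) \<and> (\<forall>b. b \<notin> B \<longrightarrow> c b = \<zero>) \<and>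
     finite {b. c b \<noteq> \<zero>} \<and> x = (\<Oplus>\<^bsub>M\<^esub>b\<in>{b. c b \<noteq> \<zero>}. c b \<odot>\<^bsub>M\<^esub> b)"
    using basis x_closed by (simp add: homogeneous_basis_def)
  ultimately show ?thesis
    unfolding coordinates_def using c out fin(2) by (intro the1_equality) auto
qed

lemma common_support:
  assumes "x \<in> carrier M" "y \<in> carrier M"
  obtains I where "finite I" "I \<subseteq> B" "\<And>b. b \<notin> I \<Longrightarrow> coordinates R M B x b = \<zero>"
    "\<And>b. b \<notin> I \<Longrightarrow> coordinates R M B y b = \<zero>"
proof (rule that)
  show "finite ({b. coordinates R M B x b \<noteq> \<zero>} \<union> {b. coordinates R M B y b \<noteq> \<zero>})"
    using coordinates_props(3)[OF assms(1)] coordinates_props(3)[OF assms(2)] by simp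
  show "{b. coordinates R M B x b \<noteq> \<zero>} \<union> {b. coordinates R M B y b \<noteq> \<zero>} \<subseteq> B"
    using coordinates_support[OF assms(1)] coordinates_support[OF assms(2)] by simp
qed simp_all

lemma coordinates_add:
  assumes x: "x \<in> carrier M" and y: "y \<in> carrier M"
  shows "coordinates R M B (x \<oplus>\<^bsub>M\<^esub> y) = (\<lambda>b. coordinates R M B x b \<oplus> coordinates R M B y b)"
proof -
  define c d where "c = coordinates R M B x" and "d = coordinates R M B y"
  have cd: "c b \<in> carrier R" "d b \<in> carrier R" for b
    using coordinates_props(1) x y by (auto simp: c_def d_def)
  obtain I where I: "finite I" "I \<subseteq> B" and out: "\<And>b. b \<notin> I \<Longrightarrow> c b = \<zero>" "\<And>b. b \<notin> I \<Longrightarrow> d b = \<zero>"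
    using common_support[OF x y] unfolding c_def d_def by blast
  have IM: "b \<in> carrier M" if "b \<in> I" for b
    using that I(2) basis_closed by auto
  have "x \<oplus>\<^bsub>M\<^esub> y = (\<Oplus>\<^bsub>M\<^esub>b\<in>I. c b \<odot>\<^bsub>M\<^esub> b) \<oplus>\<^bsub>M\<^esub> (\<Oplus>\<^bsub>M\<^esub>b\<in>I. d b \<odot>\<^bsub>M\<^esub> b)"
    using coordinates_expansion[OF x I] coordinates_expansion[OF y I] out by (simp add: c_def d_def)
  also have "\<dots> = (\<Oplus>\<^bsub>M\<^esub>b\<in>I. c b \<odot>\<^bsub>M\<^esub> b \<oplus>\<^bsub>M\<^esub> d b \<odot>\<^bsub>M\<^esub> b)"
    by (intro M.finsum_addf[symmetric] Pi_I smult_closed cd IM)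
  also have "\<dots> = (\<Oplus>\<^bsub>M\<^esub>b\<in>I. (c b \<oplus> d b) \<odot>\<^bsub>M\<^esub> b)"
    by (intro M.finsum_cong' refl Pi_I smult_closed R.a_closed cd IM smult_l_distr[symmetric])
  finally have eq: "x \<oplus>\<^bsub>M\<^esub> y = (\<Oplus>\<^bsub>M\<^esub>b\<in>I. (c b \<oplus> d b) \<odot>\<^bsub>M\<^esub> b)" .
  have "coordinates R M B (x \<oplus>\<^bsub>M\<^esub> y) = (\<lambda>b. c b \<oplus> d b)"
    by (rule coordinates_eqI[OF I _ _ eq]) (simp_all add: out cd)
  then show ?thesis by (simp add: c_def d_def)
qed

lemma coordinates_smult:
  assumes r: "r \<in> carrier R" and x: "x \<in> carrier M"
  shows "coordinates R M B (r \<odot>\<^bsub>M\<^esub> x) = (\<lambda>b. r \<otimes> coordinates R M B x b)"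
proof -
  define c where "c = coordinates R M B x"
  have c: "c b \<in> carrier R" for b
    using coordinates_props(1) x by (auto simp: c_def)
  define I where "I = {b. c b \<noteq> \<zero>}"
  have I: "finite I" "I \<subseteq> B" and out: "\<And>b. b \<notin> I \<Longrightarrow> c b = \<zero>"
    using coordinates_props(3)[OF x] coordinates_support[OF x] by (simp_all add: I_def c_def)
  have IM: "b \<in> carrier M" if "b \<in> I" for b
    using that I(2) basis_closed by auto
  have "r \<odot>\<^bsub>M\<^esub> x = r \<odot>\<^bsub>M\<^esub> (\<Oplus>\<^bsub>M\<^esub>b\<in>I. c b \<odot>\<^bsub>M\<^esub> b)"
    using coordinates_expansion[OF x I] out by (simp add: c_def)
  also have "\<dots> = (\<Oplus>\<^bsub>M\<^esub>b\<in>I. r \<odot>\<^bsub>M\<^esub> (c b \<odot>\<^bsub>M\<^esub> b))"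
    by (intro abelian_group_hom.hom_finsum[OF smult_left_hom] r Pi_I smult_closed c IM)
  also have "\<dots> = (\<Oplus>\<^bsub>M\<^esub>b\<in>I. (r \<otimes> c b) \<odot>\<^bsub>M\<^esub> b)"
    by (intro M.finsum_cong' refl Pi_I smult_closed R.m_closed r c IM smult_assoc1[symmetric])
  finally have eq: "r \<odot>\<^bsub>M\<^esub> x = (\<Oplus>\<^bsub>M\<^esub>b\<in>I. (r \<otimes> c b) \<odot>\<^bsub>M\<^esub> b)" .
  have "coordinates R M B (r \<odot>\<^bsub>M\<^esub> x) = (\<lambda>b. r \<otimes> c b)"
    by (rule coordinates_eqI[OF I _ _ eq]) (simp_all add: out c r)
  then show ?thesis by (simp add: c_def)
qed

lemma coordinates_basis:
  assumes "b \<in> B"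
  shows "coordinates R M B b = (\<lambda>b'. if b' = b then \<one> else \<zero>)"
proof (rule coordinates_eqI[where I = "{b}"])
  show "b = (\<Oplus>\<^bsub>M\<^esub>b'\<in>{b}. (if b' = b then \<one> else \<zero>) \<odot>\<^bsub>M\<^esub> b')"
    using basis_closed[OF assms] by (simp add: M.finsum_insert smult_one)
qed (use assms in auto)

lemma basis_induct [consumes 1, case_names zero add smult basis]:
  assumes x: "x \<in> carrier M" and zero: "P \<zero>\<^bsub>M\<^esub>"
    and add: "\<And>x y. \<lbrakk>x \<in> carrier M; y \<in> carrier M; P x; P y\<rbrakk> \<Longrightarrow> P (x \<oplus>\<^bsub>M\<^esub> y)"
    and smult: "\<And>r x. \<lbrakk>r \<in> carrier R; x \<in> carrier M; P x\<rbrakk> \<Longrightarrow> P (r \<odot>\<^bsub>M\<^esub> x)"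
    and gen: "\<And>b. b \<in> B \<Longrightarrow> P b"
  shows "P x"
proof -
  have "coordinates R M B x b \<odot>\<^bsub>M\<^esub> b \<in> {x \<in> carrier M. P x}"
    if "b \<in> {b. coordinates R M B x b \<noteq> \<zero>}" for b
  proof -
    have b: "b \<in> B" using that coordinates_support[OF x] by blast
    show ?thesis
      using smult smult_closed gen[OF b] basis_closed[OF b] coordinates_props(1)[OF x] by simp
  qed
  then have "(\<Oplus>\<^bsub>M\<^esub>b\<in>{b. coordinates R M B x b \<noteq> \<zero>}. coordinates R M B x b \<odot>\<^bsub>M\<^esub> b)
      \<in> {x \<in> carrier M. P x}"
    by (intro M.finsum_mem) (auto simp: zero add)
  then show ?thesis using coordinates_props(4)[OF x] by simp
qed

text \<open>
  The linear extension respects the grading because the elements on which it commutes with taking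
  homogeneous parts form a subgroup, and this subgroup contains every product of a homogeneous
  scalar with a basis element.
\<close>

lemma extend_from_basis:
  assumes "graded_ring R" "graded_module R N"
    and g: "\<And>b j. \<lbrakk>b \<in> B; b \<in> grade M j\<rbrakk> \<Longrightarrow> g b \<in> grade N (a + j)"
  obtains h where "graded_hom R M (twist N a) h" "\<And>b. b \<in> B \<Longrightarrow> h b = g b"
proof -
  interpret N: graded_module R N by fact
  interpret GR: graded_ring R by fact
  interpret GR: internal_sum R "rgrade R"
    by unfold_locales (rule GR.direct_sum)
  define c where "c = coordinates R M B"
  define h where "h x = (\<Oplus>\<^bsub>N\<^esub>b\<in>{b. c x b \<noteq> \<zero>}. c x b \<odot>\<^bsub>N\<^esub> g b)" for x
  note c_props = coordinates_props[folded c_def]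
  have gN: "g b \<in> carrier N" if "b \<in> B" for b
    using basis_homogeneous[OF that] g[OF that] N.summand_closed by blast
  have h_eq: "h x = (\<Oplus>\<^bsub>N\<^esub>b\<in>I. c x b \<odot>\<^bsub>N\<^esub> g b)"
    if "x \<in> carrier M" "finite I" "I \<subseteq> B" "\<And>b. b \<notin> I \<Longrightarrow> c x b = \<zero>" for x I
  proof -
    have cl: "c x b \<odot>\<^bsub>N\<^esub> g b \<in> carrier N" if "b \<in> I" for b
      using that \<open>I \<subseteq> B\<close> by (intro N.smult_closed c_props(1) gN \<open>x \<in> carrier M\<close>) auto
    show ?thesis
      unfolding h_def using that cl gN
      by (intro N.M.finsum_superset) auto
  qed
  have h_closed: "h x \<in> carrier N" if "x \<in> carrier M" for x
    unfolding h_def using c_props(2)[OF that]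
    by (intro N.M.finsum_closed Pi_I N.smult_closed c_props(1) gN that) auto
  have h_add: "h (x \<oplus>\<^bsub>M\<^esub> y) = h x \<oplus>\<^bsub>N\<^esub> h y" if x: "x \<in> carrier M" and y: "y \<in> carrier M" for x y
  proof -
    obtain I where I: "finite I" "I \<subseteq> B"
      and out: "\<And>b. b \<notin> I \<Longrightarrow> c x b = \<zero>" "\<And>b. b \<notin> I \<Longrightarrow> c y b = \<zero>"
      using common_support[OF x y] unfolding c_def by blast
    have IN: "g b \<in> carrier N" if "b \<in> I" for b
      using that I(2) gN by auto
    have cxy: "c (x \<oplus>\<^bsub>M\<^esub> y) b = c x b \<oplus> c y b" for b
      using coordinates_add[OF that] by (simp add: c_def)
    have "h (x \<oplus>\<^bsub>M\<^esub> y) = (\<Oplus>\<^bsub>N\<^esub>b\<in>I. (c x b \<oplus> c y b) \<odot>\<^bsub>N\<^esub> g b)"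
      using h_eq[OF M.a_closed[OF x y] I] by (simp add: cxy out)
    also have "\<dots> = (\<Oplus>\<^bsub>N\<^esub>b\<in>I. c x b \<odot>\<^bsub>N\<^esub> g b \<oplus>\<^bsub>N\<^esub> c y b \<odot>\<^bsub>N\<^esub> g b)"
      by (intro N.M.finsum_cong' refl Pi_I N.M.a_closed N.smult_closed c_props(1) x y IN N.smult_l_distr)
    also have "\<dots> = (\<Oplus>\<^bsub>N\<^esub>b\<in>I. c x b \<odot>\<^bsub>N\<^esub> g b) \<oplus>\<^bsub>N\<^esub> (\<Oplus>\<^bsub>N\<^esub>b\<in>I. c y b \<odot>\<^bsub>N\<^esub> g b)"
      by (intro N.M.finsum_addf Pi_I N.smult_closed c_props(1) x y IN)
    also have "\<dots> = h x \<oplus>\<^bsub>N\<^esub> h y"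
      using h_eq[OF x I] h_eq[OF y I] out by simp
    finally show ?thesis .
  qed
  have h_smult: "h (r \<odot>\<^bsub>M\<^esub> x) = r \<odot>\<^bsub>N\<^esub> h x" if r: "r \<in> carrier R" and x: "x \<in> carrier M" for r x
  proof -
    define I where "I = {b. c x b \<noteq> \<zero>}"
    have I: "finite I" "I \<subseteq> B" and out: "\<And>b. b \<notin> I \<Longrightarrow> c x b = \<zero>"
      using coordinates_props(3)[OF x] coordinates_support[OF x] by (simp_all add: I_def c_def)
    have IN: "g b \<in> carrier N" if "b \<in> I" for b
      using that I(2) gN by auto
    have crx: "c (r \<odot>\<^bsub>M\<^esub> x) b = r \<otimes> c x b" for b
      using coordinates_smult[OF that] by (simp add: c_def)
    have "h (r \<odot>\<^bsub>M\<^esub> x) = (\<Oplus>\<^bsub>N\<^esub>b\<in>I. (r \<otimes> c x b) \<odot>\<^bsub>N\<^esub> g b)"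
      using h_eq[OF smult_closed[OF r x] I] r by (simp add: crx out)
    also have "\<dots> = (\<Oplus>\<^bsub>N\<^esub>b\<in>I. r \<odot>\<^bsub>N\<^esub> (c x b \<odot>\<^bsub>N\<^esub> g b))"
      by (intro N.M.finsum_cong' refl Pi_I N.smult_closed c_props(1) r x IN N.smult_assoc1)
    also have "\<dots> = r \<odot>\<^bsub>N\<^esub> (\<Oplus>\<^bsub>N\<^esub>b\<in>I. c x b \<odot>\<^bsub>N\<^esub> g b)"
      by (intro abelian_group_hom.hom_finsum[OF N.smult_left_hom, symmetric] r Pi_I
          N.smult_closed c_props(1) x IN)
    also have "\<dots> = r \<odot>\<^bsub>N\<^esub> h x"
      using h_eq[OF x I] out by simp
    finally show ?thesis .
  qed
  have h_basis: "h b = g b" if "b \<in> B" for b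
  proof -
    have "h b = (\<Oplus>\<^bsub>N\<^esub>b'\<in>{b}. c b b' \<odot>\<^bsub>N\<^esub> g b')"
      using that coordinates_basis[OF that] by (intro h_eq basis_closed) (auto simp: c_def)
    then show ?thesis
      using that gN coordinates_basis[OF that] by (simp add: c_def N.smult_one N.M.finsum_insert)
  qed
  \<comment> \<open>the elements on which \<open>h\<close> commutes with taking homogeneous parts\<close>
  define E where "E = {x \<in> carrier M. \<forall>j. homogeneous_part N (a + j) (h x) = h (homogeneous_part M j x)}"
  have h_zero: "h \<zero>\<^bsub>M\<^esub> = \<zero>\<^bsub>N\<^esub>"
    using h_add[of "\<zero>\<^bsub>M\<^esub>" "\<zero>\<^bsub>M\<^esub>"] h_closed[of "\<zero>\<^bsub>M\<^esub>"] by simp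
  have E_zero: "\<zero>\<^bsub>M\<^esub> \<in> E"
    by (simp add: E_def h_zero component_zero N.component_zero)
  have E_add: "x \<oplus>\<^bsub>M\<^esub> y \<in> E" if "x \<in> E" "y \<in> E" for x y
    using that by (simp add: E_def h_add h_closed component_add N.component_add component_closed)
  have E_homogeneous: "r \<odot>\<^bsub>M\<^esub> b \<in> E" if "r \<in> rgrade R i" "b \<in> B" for r b i
  proof -
    obtain j where j: "b \<in> grade M j" using basis_homogeneous \<open>b \<in> B\<close> by blast
    have r: "r \<in> carrier R" using that(1) GR.summand_closed by simp
    have "r \<odot>\<^bsub>M\<^esub> b \<in> grade M (int i + j)" by (intro smult_homogeneous that j)
    moreover have "h (r \<odot>\<^bsub>M\<^esub> b) \<in> grade N (a + (int i + j))"
      using N.smult_homogeneous[OF that(1) g[OF that(2) j]] h_smult[OF r] basis_closed h_basis that(2)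
      by (simp add: add.left_commute)
    ultimately show ?thesis
      unfolding E_def using basis_closed[OF that(2)] r
      by (auto simp: component_of_summand N.component_of_summand h_zero intro: smult_closed)
  qed
  have E_all: "x \<in> E" if x: "x \<in> carrier M" for x
  proof -
    have "r \<odot>\<^bsub>M\<^esub> b \<in> E" if r: "r \<in> carrier R" and b: "b \<in> B" for r b
    proof -
      have "r \<odot>\<^bsub>M\<^esub> b = (\<Oplus>\<^bsub>R\<^esub>i\<in>{i. component R (rgrade R) r i \<noteq> \<zero>}. component R (rgrade R) r i) \<odot>\<^bsub>M\<^esub> b"
        using GR.component_decomposition(3)[OF r] by simp
      also have "\<dots> = (\<Oplus>\<^bsub>M\<^esub>i\<in>{i. component R (rgrade R) r i \<noteq> \<zero>}. component R (rgrade R) r i \<odot>\<^bsub>M\<^esub> b)"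
        using GR.component_closed[OF r] basis_closed[OF b]
        by (intro abelian_group_hom.hom_finsum[OF smult_right_hom]) auto
      also have "\<dots> \<in> E"
        using E_zero E_add E_homogeneous[OF GR.component_decomposition(1)[OF r] b]
        by (intro M.finsum_mem) (auto simp: E_def)
      finally show ?thesis .
    qed
    then have "(\<Oplus>\<^bsub>M\<^esub>b\<in>{b. c x b \<noteq> \<zero>}. c x b \<odot>\<^bsub>M\<^esub> b) \<in> E"
      using c_props(1,2)[OF x] E_zero E_add by (intro M.finsum_mem) (auto simp: E_def)
    then show ?thesis using c_props(4)[OF x] by simp
  qed
  have h_grade: "h x \<in> grade N (a + j)" if "x \<in> grade M j" for x j
  proof -
    have "x \<in> E" using E_all summand_closed[OF that] by simp
    then have "h x = homogeneous_part N (a + j) (h x)"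
      using that by (simp add: E_def component_of_summand)
    then show ?thesis
      using N.component_decomposition(1) h_closed summand_closed[OF that] by metis
  qed
  show thesis
  proof
    show "graded_hom R M (twist N a) h"
      unfolding graded_hom_def using h_closed h_add h_smult h_grade by auto
  qed (rule h_basis)
qed

end

section \<open>Direct sums of graded modules\<close>

lemma graded_hom_comp:
  assumes "graded_hom R M (twist N a) f" "graded_hom R N (twist P b) g"
  shows "graded_hom R M (twist P (a + b)) (\<lambda>x. g (f x))"
proof -
  note f = graded_homD[OF assms(1), simplified] and g = graded_homD[OF assms(2), simplified]
  have "g (f x) \<in> grade P (a + (b + j))" if "x \<in> grade M j" for x j
    using g(4)[OF f(4)[OF that]] by (simp add: add.left_commute)
  then show ?thesis
    unfolding graded_hom_def by (auto simp: f g add.assoc)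
qed

lemma graded_hom_add:
  assumes "graded_module R N" "graded_hom R M (twist N a) f" "graded_hom R M (twist N a) g"
  shows "graded_hom R M (twist N a) (\<lambda>x. f x \<oplus>\<^bsub>N\<^esub> g x)"
proof -
  interpret N: graded_module R N by fact
  note f = graded_homD[OF assms(2), simplified] and g = graded_homD[OF assms(3), simplified]
  show ?thesis
    unfolding graded_hom_def
    using additive_subgroup.a_closed[OF N.summand_subgroup]
    by (auto simp: f g N.smult_r_distr N.M.a_ac)
qed

lemma graded_hom_zero:
  assumes "graded_module R N"
  shows "graded_hom R M (twist N a) (\<lambda>x. \<zero>\<^bsub>N\<^esub>)"
proof -
  interpret N: graded_module R N by fact
  show ?thesis
    unfolding graded_hom_def by (auto simp: N.zero_in_summand)
qed

lemma direct_sum_simps: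
  "carrier (direct_sum_module F) = {x. (\<forall>i. x i \<in> carrier (F i)) \<and> finite {i. x i \<noteq> \<zero>\<^bsub>F i\<^esub>}}"
  "zero (direct_sum_module F) = (\<lambda>i. \<zero>\<^bsub>F i\<^esub>)"
  "add (direct_sum_module F) x y = (\<lambda>i. x i \<oplus>\<^bsub>F i\<^esub> y i)"
  "smult (direct_sum_module F) r x = (\<lambda>i. r \<odot>\<^bsub>F i\<^esub> x i)"
  "grade (direct_sum_module F) j = {x \<in> carrier (direct_sum_module F). \<forall>i. x i \<in> grade (F i) j}"
  by (auto simp: direct_sum_module_def Let_def)

locale graded_family =
  fixes R :: "'r gring" and F :: "nat \<Rightarrow> ('r, 'm) gmodule"
  assumes graded_scalars: "graded_ring R"
    and summand: "graded_module R (F i)"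
begin

sublocale F: graded_module R "F i" for i
  by (rule summand)

abbreviation S :: "('r, nat \<Rightarrow> 'm) gmodule" where
  "S \<equiv> direct_sum_module F"

lemma apply_closed: "x \<in> carrier S \<Longrightarrow> x i \<in> carrier (F i)"
  by (simp add: direct_sum_simps)

lemma add_closed:
  assumes "x \<in> carrier S" "y \<in> carrier S"
  shows "x \<oplus>\<^bsub>S\<^esub> y \<in> carrier S"
proof -
  have "{i. x i \<oplus>\<^bsub>F i\<^esub> y i \<noteq> \<zero>\<^bsub>F i\<^esub>} \<subseteq> {i. x i \<noteq> \<zero>\<^bsub>F i\<^esub>} \<union> {i. y i \<noteq> \<zero>\<^bsub>F i\<^esub>}"
    by auto
  then show ?thesis
    using assms by (auto simp: direct_sum_simps intro: finite_subset)
qed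

lemma pointwise_closed:
  assumes "x \<in> carrier S" and "\<And>i. u i \<in> carrier (F i)" and "\<And>i. x i = \<zero>\<^bsub>F i\<^esub> \<Longrightarrow> u i = \<zero>\<^bsub>F i\<^esub>"
  shows "u \<in> carrier S"
proof -
  have "{i. u i \<noteq> \<zero>\<^bsub>F i\<^esub>} \<subseteq> {i. x i \<noteq> \<zero>\<^bsub>F i\<^esub>}"
    using assms(3) by auto
  then show ?thesis
    using assms by (auto simp: direct_sum_simps intro: finite_subset)
qed

lemma smult_closed: "\<lbrakk>r \<in> carrier R; x \<in> carrier S\<rbrakk> \<Longrightarrow> r \<odot>\<^bsub>S\<^esub> x \<in> carrier S"
  by (rule pointwise_closed[where x = x])
    (auto simp: direct_sum_simps F.smult_closed)

lemma abelian_group_direct_sum: "abelian_group S"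
proof (rule abelian_groupI)
  show "\<zero>\<^bsub>S\<^esub> \<in> carrier S"
    by (simp add: direct_sum_simps)
  show "\<exists>y\<in>carrier S. y \<oplus>\<^bsub>S\<^esub> x = \<zero>\<^bsub>S\<^esub>" if "x \<in> carrier S" for x
  proof
    show "(\<lambda>i. \<ominus>\<^bsub>F i\<^esub> x i) \<in> carrier S"
      using that by (intro pointwise_closed[OF that]) (auto simp: apply_closed)
    show "(\<lambda>i. \<ominus>\<^bsub>F i\<^esub> x i) \<oplus>\<^bsub>S\<^esub> x = \<zero>\<^bsub>S\<^esub>"
      using that by (simp add: direct_sum_simps F.M.l_neg)
  qed
qed (auto simp: add_closed, auto simp: direct_sum_simps F.M.a_ac)

lemma apply_hom: "abelian_group_hom S (F i) (\<lambda>x. x i)"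
  by (intro abelian_group_hom_of_additive abelian_group_direct_sum F.M.abelian_group_axioms)
    (auto simp: apply_closed, simp add: direct_sum_simps)

lemma finsum_apply:
  "g \<in> I \<rightarrow> carrier S \<Longrightarrow> finsum S g I i = finsum (F i) (\<lambda>k. g k i) I"
  by (rule abelian_group_hom.hom_finsum[OF apply_hom])

lemma graded_module_direct_sum: "graded_module R S"
proof -
  interpret S: abelian_group S by (rule abelian_group_direct_sum)
  have "internal_direct_sum S (grade S)"
  proof (rule S.internal_direct_sumI[where p = "\<lambda>j x i. homogeneous_part (F i) j (x i)"])
    have pS: "(\<lambda>i. homogeneous_part (F i) j (x i)) \<in> carrier S" if "x \<in> carrier S" for j x
      by (rule pointwise_closed[OF that])
        (use that in \<open>auto simp: apply_closed F.component_closed F.component_zero\<close>)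
    show "abelian_group_hom S S (\<lambda>x i. homogeneous_part (F i) j (x i))" for j
      by (intro abelian_group_hom_of_additive S.abelian_group_axioms)
        (use pS in \<open>auto simp: fun_eq_iff direct_sum_simps F.component_add\<close>)
    show "additive_subgroup (grade S j) S" for j
    proof (intro additive_subgroupI S.add.subgroupI)
      show "grade S j \<noteq> {}"
        using S.zero_closed F.zero_in_summand by (simp add: direct_sum_simps(2,5)) blast
      fix x assume x: "x \<in> grade S j"
      then have "(\<ominus>\<^bsub>S\<^esub> x) i = \<ominus>\<^bsub>F i\<^esub> x i" for i
        using abelian_group_hom.hom_a_inv[OF apply_hom, of x i] by (simp add: direct_sum_simps(5))
      with x show "\<ominus>\<^bsub>S\<^esub> x \<in> grade S j"
        using additive_subgroup.a_inv_closed[OF F.summand_subgroup] by (simp add: direct_sum_simps(5))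
      fix y assume "y \<in> grade S j"
      with x show "x \<oplus>\<^bsub>S\<^esub> y \<in> grade S j"
        using S.a_closed additive_subgroup.a_closed[OF F.summand_subgroup]
        by (simp add: direct_sum_simps(3,5))
    qed (auto simp: direct_sum_simps(5))
    show "(\<lambda>i. homogeneous_part (F i) j (x i)) \<in> grade S j" if "x \<in> carrier S" for x j
      using pS[OF that] apply_closed[OF that]
      by (simp add: direct_sum_simps(5) F.component_decomposition(1))
    show "(\<lambda>i. homogeneous_part (F i) j (x i)) = (if j = k then x else \<zero>\<^bsub>S\<^esub>)"
      if "x \<in> grade S k" for x j k
    proof
      fix i
      have "x i \<in> grade (F i) k"
        using that by (simp add: direct_sum_simps(5))
      from F.component_of_summand[OF this]
      show "homogeneous_part (F i) j (x i) = (if j = k then x else \<zero>\<^bsub>S\<^esub>) i"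
        by (simp add: direct_sum_simps(2))
    qed
    fix x assume x: "x \<in> carrier S"
    define J where "J = {j. (\<lambda>i. homogeneous_part (F i) j (x i)) \<noteq> \<zero>\<^bsub>S\<^esub>}"
    have "J \<subseteq> (\<Union>i\<in>{i. x i \<noteq> \<zero>\<^bsub>F i\<^esub>}. {j. homogeneous_part (F i) j (x i) \<noteq> \<zero>\<^bsub>F i\<^esub>})"
    proof
      fix j assume "j \<in> J"
      then obtain i where i: "homogeneous_part (F i) j (x i) \<noteq> \<zero>\<^bsub>F i\<^esub>"
        by (auto simp: J_def direct_sum_simps fun_eq_iff)
      then have "x i \<noteq> \<zero>\<^bsub>F i\<^esub>"
        using F.component_zero by metis
      with i show "j \<in> (\<Union>i\<in>{i. x i \<noteq> \<zero>\<^bsub>F i\<^esub>}. {j. homogeneous_part (F i) j (x i) \<noteq> \<zero>\<^bsub>F i\<^esub>})"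
        by auto
    qed
    moreover have "finite \<dots>"
      using x by (intro finite_UN_I) (auto simp: direct_sum_simps intro: F.component_decomposition(2))
    ultimately have fin: "finite J" by (rule finite_subset)
    then show "finite {j. (\<lambda>i. homogeneous_part (F i) j (x i)) \<noteq> \<zero>\<^bsub>S\<^esub>}"
      by (simp add: J_def)
    have "x = (\<Oplus>\<^bsub>S\<^esub>j\<in>J. (\<lambda>i. homogeneous_part (F i) j (x i)))"
    proof
      fix i
      have xi: "x i \<in> carrier (F i)" using apply_closed[OF x] .
      have "x i = (\<Oplus>\<^bsub>F i\<^esub>j\<in>{j. homogeneous_part (F i) j (x i) \<noteq> \<zero>\<^bsub>F i\<^esub>}. homogeneous_part (F i) j (x i))"
        by (rule F.component_decomposition(3)[OF xi])
      also have "\<dots> = (\<Oplus>\<^bsub>F i\<^esub>j\<in>J. homogeneous_part (F i) j (x i))"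
        using F.component_closed[OF xi] fin
        by (intro F.M.finsum_superset) (auto simp: J_def direct_sum_simps fun_eq_iff)
      also have "\<dots> = (\<Oplus>\<^bsub>S\<^esub>j\<in>J. (\<lambda>i. homogeneous_part (F i) j (x i))) i"
        using pS[OF x] by (intro finsum_apply[symmetric]) auto
      finally show "x i = (\<Oplus>\<^bsub>S\<^esub>j\<in>J. (\<lambda>i. homogeneous_part (F i) j (x i))) i" .
    qed
    then show "x = (\<Oplus>\<^bsub>S\<^esub>j\<in>{j. (\<lambda>i. homogeneous_part (F i) j (x i)) \<noteq> \<zero>\<^bsub>S\<^esub>}.
        (\<lambda>i. homogeneous_part (F i) j (x i)))"
      by (simp add: J_def)
  qed
  moreover have "r \<odot>\<^bsub>S\<^esub> x \<in> grade S (int i + j)" if "r \<in> rgrade R i" "x \<in> grade S j" for r x i j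
  proof -
    interpret R: internal_sum R "rgrade R"
      using graded_scalars
      by (simp add: graded_ring_def graded_ring_axioms_def ring_def internal_sum_def internal_sum_axioms_def)
    have "r \<in> carrier R"
      using that(1) by (rule R.summand_closed)
    with that show ?thesis
      using smult_closed F.smult_homogeneous by (auto simp: direct_sum_simps(4,5))
  qed
  ultimately show ?thesis
    using smult_closed F.R.ring_axioms S.abelian_group_axioms
    unfolding graded_module_def graded_module_axioms_def left_module_def left_module_axioms_def
    by (auto simp: direct_sum_simps(3,4) apply_closed F.smult_l_distr F.smult_r_distr
        F.smult_assoc1 F.smult_one)
qed

end

lemma inclusion_apply [simp]:
  "inclusion F i x i = x" "k \<noteq> i \<Longrightarrow> inclusion F i x k = \<zero>\<^bsub>F k\<^esub>"
  by (auto simp: inclusion_def)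

context graded_family
begin

lemma inclusion_closed:
  assumes "x \<in> carrier (F i)"
  shows "inclusion F i x \<in> carrier S"
proof -
  have "{k. inclusion F i x k \<noteq> \<zero>\<^bsub>F k\<^esub>} \<subseteq> {i}"
    by (auto simp: inclusion_def)
  then have "finite {k. inclusion F i x k \<noteq> \<zero>\<^bsub>F k\<^esub>}"
    by (rule finite_subset) simp
  then show ?thesis
    using assms by (auto simp: direct_sum_simps, simp add: inclusion_def)
qed

lemma inclusion_hom: "graded_hom R (F i) S (inclusion F i)"
  unfolding graded_hom_def
proof (intro conjI ballI allI)
  show "inclusion F i ` grade (F i) j \<subseteq> grade S j" for j
    using inclusion_closed F.summand_closed F.zero_in_summand
    by (auto simp: direct_sum_simps(5), auto simp: inclusion_def)
qed (auto simp: inclusion_closed, auto simp: inclusion_def direct_sum_simps(3,4) fun_eq_iff)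

lemma apply_graded_hom: "graded_hom R S (F i) (\<lambda>x. x i)"
  unfolding graded_hom_def by (auto simp: apply_closed) (simp_all add: direct_sum_simps)

sublocale S: graded_module R S
  by (rule graded_module_direct_sum)

definition supported_below :: "nat \<Rightarrow> (nat \<Rightarrow> 'm) \<Rightarrow> bool" where
  "supported_below n x \<longleftrightarrow> (\<forall>k\<ge>n. x k = \<zero>\<^bsub>F k\<^esub>)"

lemma supported_belowD: "\<lbrakk>supported_below n x; n \<le> k\<rbrakk> \<Longrightarrow> x k = \<zero>\<^bsub>F k\<^esub>"
  by (simp add: supported_below_def)

lemma supported_below_mono: "\<lbrakk>supported_below m x; m \<le> n\<rbrakk> \<Longrightarrow> supported_below n x"
  by (simp add: supported_below_def)

lemma supported_below_zero: "supported_below n \<zero>\<^bsub>S\<^esub>"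
  by (simp add: supported_below_def direct_sum_simps)

lemma supported_below_0_iff: "supported_below 0 x \<longleftrightarrow> x = \<zero>\<^bsub>S\<^esub>"
  by (auto simp: supported_below_def direct_sum_simps)

lemma supported_below_add:
  "\<lbrakk>supported_below n x; supported_below n y\<rbrakk> \<Longrightarrow> supported_below n (x \<oplus>\<^bsub>S\<^esub> y)"
  by (simp add: supported_below_def direct_sum_simps)

lemma supported_below_smult:
  "\<lbrakk>r \<in> carrier R; supported_below n x\<rbrakk> \<Longrightarrow> supported_below n (r \<odot>\<^bsub>S\<^esub> x)"
  by (simp add: supported_below_def direct_sum_simps)

lemma minus_apply:
  assumes "x \<in> carrier S" "y \<in> carrier S"
  shows "(x \<ominus>\<^bsub>S\<^esub> y) i = x i \<ominus>\<^bsub>F i\<^esub> y i"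
proof -
  have "(\<ominus>\<^bsub>S\<^esub> y) i = \<ominus>\<^bsub>F i\<^esub> y i"
    by (rule abelian_group_hom.hom_a_inv[OF apply_hom assms(2)])
  then show ?thesis
    by (simp add: S.M.minus_eq F.M.minus_eq direct_sum_simps)
qed

lemma supported_below_inclusion: "supported_below (Suc i) (inclusion F i x)"
  by (simp add: supported_below_def)

lemma supported_below_exists:
  assumes "x \<in> carrier S"
  obtains n where "supported_below n x"
proof -
  have "finite {i. x i \<noteq> \<zero>\<^bsub>F i\<^esub>}" using assms by (simp add: direct_sum_simps)
  then obtain n where "\<forall>i\<in>{i. x i \<noteq> \<zero>\<^bsub>F i\<^esub>}. i < n"
    unfolding finite_nat_set_iff_bounded by blast
  then have "supported_below n x"
    unfolding supported_below_def by force
  then show thesis by (rule that)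
qed

end

section \<open>Homology classes\<close>

lemma cycles_simps:
  "carrier (cycles D d) = {x \<in> carrier D. d x = \<zero>\<^bsub>D\<^esub>}"
  "grade (cycles D d) j = grade D j \<inter> {x \<in> carrier D. d x = \<zero>\<^bsub>D\<^esub>}"
  "smult (cycles D d) = smult D"
  by (simp_all add: cycles_def graded_submodule_def a_kernel_def')

lemma coset_cycles: "N +>\<^bsub>cycles D d\<^esub> x = N +>\<^bsub>D\<^esub> x"
  unfolding a_r_coset_def' by (simp add: cycles_def graded_submodule_def)

lemma set_add_cycles: "set_add (cycles D d) = set_add D"
  by (intro ext) (simp only: set_add_def', simp add: cycles_def graded_submodule_def)

locale differential_module = graded_module R D for R :: "'r gring" and D :: "('r, 'd) gmodule" +
  fixes a :: int and d :: "'d \<Rightarrow> 'd"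
  assumes diff: "diff_module R a D d"
begin

abbreviation homology_class :: "'d \<Rightarrow> 'd set" where
  "homology_class x \<equiv> boundaries D d +>\<^bsub>D\<^esub> x"

lemma d_hom: "graded_hom R D (twist D a) d"
  using diff by (simp add: diff_module_def)

lemma d_abelian_hom: "abelian_group_hom D D d"
  by (rule graded_hom_abelian[OF M.abelian_group_axioms M.abelian_group_axioms d_hom])

sublocale d: abelian_group_hom D D d
  by (rule d_abelian_hom)

lemma d_smult: "\<lbrakk>r \<in> carrier R; x \<in> carrier D\<rbrakk> \<Longrightarrow> d (r \<odot>\<^bsub>D\<^esub> x) = r \<odot>\<^bsub>D\<^esub> d x"
  using graded_homD(3)[OF d_hom] by simp

lemma d_d: "x \<in> carrier D \<Longrightarrow> d (d x) = \<zero>\<^bsub>D\<^esub>"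
  using diff by (simp add: diff_module_def)

lemma boundaries_subgroup: "abelian_subgroup (boundaries D d) D"
proof (rule abelian_subgroupI3[OF _ M.abelian_group_axioms], rule additive_subgroupI,
    rule M.add.subgroupI)
  show "boundaries D d \<subseteq> carrier D" "boundaries D d \<noteq> {}"
    by (auto simp: boundaries_def d.hom_closed)
  show "\<ominus>\<^bsub>D\<^esub> x \<in> boundaries D d" if "x \<in> boundaries D d" for x
    using that by (auto simp: boundaries_def simp flip: d.hom_a_inv)
  show "x \<oplus>\<^bsub>D\<^esub> y \<in> boundaries D d" if "x \<in> boundaries D d" "y \<in> boundaries D d" for x y
    using that by (auto simp: boundaries_def simp flip: d.hom_add)
qed

sublocale B: abelian_subgroup "boundaries D d" D
  by (rule boundaries_subgroup)

lemma boundaries_smult: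
  "\<lbrakk>r \<in> carrier R; x \<in> boundaries D d\<rbrakk> \<Longrightarrow> r \<odot>\<^bsub>D\<^esub> x \<in> boundaries D d"
  by (auto simp: boundaries_def smult_closed simp flip: d_smult)

lemma class_eq_iff:
  assumes "x \<in> carrier D" "y \<in> carrier D"
  shows "homology_class x = homology_class y \<longleftrightarrow> x \<ominus>\<^bsub>D\<^esub> y \<in> boundaries D d"
  using B.a_rcos_module[OF assms(2,1)] B.a_repr_independence'[of x y] B.a_rcos_self[OF assms(1)] assms
  by (auto simp: M.minus_eq)

lemma class_eq_boundaries_iff:
  assumes "x \<in> carrier D"
  shows "homology_class x = boundaries D d \<longleftrightarrow> x \<in> boundaries D d"
  using class_eq_iff[OF assms M.zero_closed] assms B.a_subset
  by (simp add: M.diff_zero)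

lemma classE:
  assumes "y \<in> homology_class x"
  obtains b where "b \<in> boundaries D d" "y = b \<oplus>\<^bsub>D\<^esub> x"
  using assms unfolding a_r_coset_def' by (elim UN_E singletonE)

lemma class_add_boundary:
  assumes "b \<in> boundaries D d" "x \<in> carrier D"
  shows "homology_class (b \<oplus>\<^bsub>D\<^esub> x) = homology_class x"
  using B.a_repr_independence'[OF M.a_rcosI[OF assms(1) B.a_subset assms(2)] assms(2)] by (rule sym)

lemma homology_carrier:
  "carrier (homology D d) = homology_class ` {x \<in> carrier D. d x = \<zero>\<^bsub>D\<^esub>}"
  by (simp add: homology_def quotient_module_def A_RCOSETS_def' cycles_simps coset_cycles UNION_singleton_eq_range)

lemma homology_zero: "zero (homology D d) = boundaries D d"
  by (simp add: homology_def quotient_module_def)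

lemma homology_grade:
  "grade (homology D d) j = homology_class ` {x \<in> grade D j. d x = \<zero>\<^bsub>D\<^esub>}"
proof -
  have "grade (cycles D d) j = {x \<in> grade D j. d x = \<zero>\<^bsub>D\<^esub>}"
    using summand_closed by (auto simp: cycles_simps)
  then show ?thesis
    by (simp add: homology_def quotient_module_def coset_cycles)
qed

lemma homology_add:
  assumes "x \<in> carrier D" "y \<in> carrier D"
  shows "homology_class x \<oplus>\<^bsub>homology D d\<^esub> homology_class y = homology_class (x \<oplus>\<^bsub>D\<^esub> y)"
proof -
  have "add (homology D d) = set_add D"
    by (simp add: homology_def quotient_module_def set_add_cycles)
  then show ?thesis using B.a_rcos_sum assms by simp
qed

lemma homology_smult:
  assumes r: "r \<in> carrier R" and x: "x \<in> carrier D"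
  shows "r \<odot>\<^bsub>homology D d\<^esub> homology_class x = homology_class (r \<odot>\<^bsub>D\<^esub> x)"
proof -
  have "homology_class (r \<odot>\<^bsub>D\<^esub> y) = homology_class (r \<odot>\<^bsub>D\<^esub> x)" if y: "y \<in> homology_class x" for y
  proof -
    obtain b where b: "b \<in> boundaries D d" "y = b \<oplus>\<^bsub>D\<^esub> x"
      using y by (rule classE)
    have "r \<odot>\<^bsub>D\<^esub> y = r \<odot>\<^bsub>D\<^esub> b \<oplus>\<^bsub>D\<^esub> r \<odot>\<^bsub>D\<^esub> x"
      unfolding b(2) using r x B.a_Hcarr[OF b(1)] by (intro smult_r_distr)
    then show ?thesis
      by (simp only: class_add_boundary boundaries_smult r b(1) smult_closed x)
  qed
  moreover have "x \<in> homology_class x"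
    using x by (rule B.a_rcos_self)
  ultimately have "(\<Union>y\<in>homology_class x. homology_class (r \<odot>\<^bsub>D\<^esub> y)) = homology_class (r \<odot>\<^bsub>D\<^esub> x)"
    by blast
  then show ?thesis
    by (simp add: homology_def quotient_module_def cycles_simps coset_cycles)
qed

end

text \<open>
  On homology classes the induced map is \<open>[x] \<mapsto> [f x]\<close>, so bijectivity on homology can be checked
  on cycles; injectivity reduces to the zero class by linearity.
\<close>

lemma quasi_isomorphismI:
  assumes "differential_module R M a dM" "differential_module R D a dD"
    and f: "graded_hom R M D f" and comm: "\<And>x. x \<in> carrier M \<Longrightarrow> f (dM x) = dD (f x)"
    and surj: "\<And>z. \<lbrakk>z \<in> carrier D; dD z = \<zero>\<^bsub>D\<^esub>\<rbrakk> \<Longrightarrow>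
        \<exists>x\<in>carrier M. dM x = \<zero>\<^bsub>M\<^esub> \<and> z \<ominus>\<^bsub>D\<^esub> f x \<in> boundaries D dD"
    and inj: "\<And>x. \<lbrakk>x \<in> carrier M; dM x = \<zero>\<^bsub>M\<^esub>; f x \<in> boundaries D dD\<rbrakk> \<Longrightarrow> x \<in> boundaries M dM"
  shows "quasi_isomorphism R M dM D dD f"
proof -
  interpret M: differential_module R M a dM by fact
  interpret D: differential_module R D a dD by fact
  interpret f: abelian_group_hom M D f
    using graded_hom_abelian[OF M.M.abelian_group_axioms D.M.abelian_group_axioms, of R 0 f] f by simp
  let ?h = "homology_map D dD f"
  have fB: "f b \<in> boundaries D dD" if "b \<in> boundaries M dM" for b
    using that comm by (auto simp: boundaries_def f.hom_closed)
  have h: "?h (M.homology_class x) = D.homology_class (f x)" if x: "x \<in> carrier M" for x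
  proof -
    have "D.homology_class (f y) = D.homology_class (f x)" if y: "y \<in> M.homology_class x" for y
    proof -
      obtain b where b: "b \<in> boundaries M dM" "y = b \<oplus>\<^bsub>M\<^esub> x"
        using y by (rule M.classE)
      then have "f y = f b \<oplus>\<^bsub>D\<^esub> f x"
        using x M.B.a_Hcarr by simp
      then show ?thesis
        by (simp only: D.class_add_boundary fB b(1) f.hom_closed x)
    qed
    moreover have "x \<in> M.homology_class x"
      using x by (rule M.B.a_rcos_self)
    ultimately show ?thesis unfolding homology_map_def by blast
  qed
  have f_cycle: "dD (f x) = \<zero>\<^bsub>D\<^esub>" if "x \<in> carrier M" "dM x = \<zero>\<^bsub>M\<^esub>" for x
    using comm[OF that(1)] that by simp
  have fg: "f x \<in> grade D j" if "x \<in> grade M j" for x j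
    using graded_homD(4)[OF f that] .
  have fs: "f (r \<odot>\<^bsub>M\<^esub> x) = r \<odot>\<^bsub>D\<^esub> f x" if "r \<in> carrier R" "x \<in> carrier M" for r x
    using graded_homD(3)[OF f that] .
  have "graded_hom R (homology M dM) (homology D dD) ?h"
    unfolding graded_hom_def
  proof (intro conjI ballI allI)
    show "?h \<in> carrier (homology M dM) \<rightarrow> carrier (homology D dD)"
      by (auto simp: M.homology_carrier D.homology_carrier h f_cycle f.hom_closed)
    show "?h ` grade (homology M dM) j \<subseteq> grade (homology D dD) j" for j
      using M.summand_closed by (auto simp: M.homology_grade D.homology_grade h f_cycle fg)
    show "?h (A \<oplus>\<^bsub>homology M dM\<^esub> A') = ?h A \<oplus>\<^bsub>homology D dD\<^esub> ?h A'"
      if "A \<in> carrier (homology M dM)" "A' \<in> carrier (homology M dM)" for A A'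
      using that by (auto simp: M.homology_carrier M.homology_add D.homology_add h f.hom_closed)
    show "?h (r \<odot>\<^bsub>homology M dM\<^esub> A) = r \<odot>\<^bsub>homology D dD\<^esub> ?h A"
      if "r \<in> carrier R" "A \<in> carrier (homology M dM)" for r A
      using that by (auto simp: M.homology_carrier M.homology_smult D.homology_smult h
          f.hom_closed fs M.smult_closed)
  qed
  moreover have "inj_on ?h (carrier (homology M dM))"
  proof (rule inj_onI)
    fix A A' assume "A \<in> carrier (homology M dM)" "A' \<in> carrier (homology M dM)" and eq: "?h A = ?h A'"
    then obtain x y where x: "x \<in> carrier M" "dM x = \<zero>\<^bsub>M\<^esub>" "A = M.homology_class x"
      and y: "y \<in> carrier M" "dM y = \<zero>\<^bsub>M\<^esub>" "A' = M.homology_class y"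
      by (auto simp: M.homology_carrier)
    have "f x \<ominus>\<^bsub>D\<^esub> f y \<in> boundaries D dD"
      using eq x y by (simp add: h D.class_eq_iff f.hom_closed)
    then have "f (x \<ominus>\<^bsub>M\<^esub> y) \<in> boundaries D dD"
      using x y by (simp add: M.M.minus_eq D.M.minus_eq)
    moreover have "dM (x \<ominus>\<^bsub>M\<^esub> y) = \<zero>\<^bsub>M\<^esub>"
      using x y by (simp add: M.M.minus_eq)
    ultimately show "A = A'"
      using x y inj by (simp add: M.class_eq_iff)
  qed
  moreover have "carrier (homology D dD) \<subseteq> ?h ` carrier (homology M dM)"
  proof
    fix A assume "A \<in> carrier (homology D dD)"
    then obtain z where z: "z \<in> carrier D" "dD z = \<zero>\<^bsub>D\<^esub>" "A = D.homology_class z"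
      by (auto simp: D.homology_carrier)
    obtain x where x: "x \<in> carrier M" "dM x = \<zero>\<^bsub>M\<^esub>" "z \<ominus>\<^bsub>D\<^esub> f x \<in> boundaries D dD"
      using surj z by blast
    then have "A = ?h (M.homology_class x)"
      using z by (simp add: h D.class_eq_iff f.hom_closed)
    with x show "A \<in> ?h ` carrier (homology M dM)"
      by (auto simp: M.homology_carrier)
  qed
  ultimately show ?thesis
    unfolding quasi_isomorphism_def graded_iso_def diff_morphism_def bij_betw_def
    using f comm by (auto simp: graded_hom_def)
qed

section \<open>Exactness inside a partially built flag\<close>

locale homology_resolution =
  graded_family R F + D: differential_module R D a dD
  for R :: "'r gring" and F :: "nat \<Rightarrow> ('r, 'f) gmodule"
    and D :: "('r, 'd) gmodule" and a :: int and dD :: "'d \<Rightarrow> 'd" +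
  fixes \<delta> :: "nat \<Rightarrow> 'f \<Rightarrow> 'f" and \<epsilon> :: "'f \<Rightarrow> 'd set"
  assumes free: "graded_free R (F i)"
    and \<delta>_hom: "graded_hom R (F (Suc i)) (twist (F i) a) (\<delta> (Suc i))"
    and \<epsilon>_hom: "graded_hom R (F 0) (homology D dD) \<epsilon>"
    and \<epsilon>_surj: "\<epsilon> ` carrier (F 0) = carrier (homology D dD)"
    and exact_0: "\<delta> (Suc 0) ` carrier (F (Suc 0)) = {x \<in> carrier (F 0). \<epsilon> x = boundaries D dD}"
    and exact_Suc: "\<delta> (Suc (Suc i)) ` carrier (F (Suc (Suc i))) =
          {x \<in> carrier (F (Suc i)). \<delta> (Suc i) x = \<zero>\<^bsub>F i\<^esub>}"
begin

lemma \<delta>_abelian_hom: "abelian_group_hom (F (Suc i)) (F i) (\<delta> (Suc i))"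
  by (rule graded_hom_abelian[OF F.M.abelian_group_axioms F.M.abelian_group_axioms \<delta>_hom])

lemma \<delta>_smult:
  "\<lbrakk>r \<in> carrier R; x \<in> carrier (F (Suc i))\<rbrakk> \<Longrightarrow> \<delta> (Suc i) (r \<odot>\<^bsub>F (Suc i)\<^esub> x) = r \<odot>\<^bsub>F i\<^esub> \<delta> (Suc i) x"
  using graded_homD(3)[OF \<delta>_hom] by simp

end

text \<open>
  A differential \<open>d\<close> and a chain map \<open>f\<close> on the whole direct sum, where the leading term of \<open>d\<close> is
  prescribed on the summands up to \<open>F n\<close> only. Keeping the whole sum as the domain avoids working
  with the modules \<open>F 0 \<oplus> \<dots> \<oplus> F n\<close> separately; the complete flag satisfies these conditions for
  every \<open>n\<close>.
\<close>

locale flag_up_to = homology_resolution R F D a dD \<delta> \<epsilon>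
  for R :: "'r gring" and F :: "nat \<Rightarrow> ('r, 'f) gmodule"
    and D :: "('r, 'd) gmodule" and a :: int and dD :: "'d \<Rightarrow> 'd"
    and \<delta> :: "nat \<Rightarrow> 'f \<Rightarrow> 'f" and \<epsilon> :: "'f \<Rightarrow> 'd set" +
  fixes n :: nat and d :: "(nat \<Rightarrow> 'f) \<Rightarrow> (nat \<Rightarrow> 'f)" and f :: "(nat \<Rightarrow> 'f) \<Rightarrow> 'd"
  assumes d_hom: "graded_hom R S (twist S a) d"
    and f_hom: "graded_hom R S D f"
    and d_d: "x \<in> carrier S \<Longrightarrow> d (d x) = \<zero>\<^bsub>S\<^esub>"
    and f_d: "x \<in> carrier S \<Longrightarrow> f (d x) = dD (f x)"
    and d_lowers: "\<lbrakk>x \<in> carrier S; supported_below (Suc m) x\<rbrakk> \<Longrightarrow> supported_below m (d x)"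
    and d_top: "\<lbrakk>x \<in> carrier S; m < n; supported_below (Suc (Suc m)) x\<rbrakk> \<Longrightarrow>
        d x m = \<delta> (Suc m) (x (Suc m))"
    and f_bottom: "t \<in> carrier (F 0) \<Longrightarrow> \<epsilon> t = D.homology_class (f (inclusion F 0 t))"
begin

sublocale d: abelian_group_hom S S d
  by (rule graded_hom_abelian[OF S.M.abelian_group_axioms S.M.abelian_group_axioms d_hom])

sublocale f: abelian_group_hom S D f
  using f_hom by (intro graded_hom_abelian[where a = 0] S.M.abelian_group_axioms D.M.abelian_group_axioms) simp

text \<open>
  Induction on the support of \<open>u\<close>. Exactness at \<open>F m\<close> turns the leading term \<open>u m\<close> into \<open>\<delta> v\<close>, and
  replacing \<open>u\<close> by \<open>u - d v\<close> removes it. The hypothesis on \<open>f u\<close> enters at the summand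
  \<open>F 0\<close>, where exactness requires \<open>\<epsilon> (u 0)\<close> to vanish in homology.
\<close>

lemma bounds_if_image_bounds:
  assumes "u \<in> carrier S" "supported_below m u" "m \<le> n" "d u = \<zero>\<^bsub>S\<^esub>" "f u \<in> boundaries D dD"
  shows "\<exists>w\<in>carrier S. supported_below (Suc m) w \<and> d w = u"
  using assms
proof (induction m arbitrary: u)
  case 0
  then have "u = \<zero>\<^bsub>S\<^esub>" by (simp add: supported_below_0_iff)
  then show ?case
    by (intro bexI[of _ "\<zero>\<^bsub>S\<^esub>"]) (simp_all add: supported_below_zero)
next
  case (Suc m)
  have um: "u m \<in> carrier (F m)" using Suc.prems by (intro apply_closed)
  have "u m \<in> \<delta> (Suc m) ` carrier (F (Suc m))"
  proof (cases m)
    case 0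
    have "u = inclusion F 0 (u 0)"
    proof
      show "u k = inclusion F 0 (u 0) k" for k
        using Suc.prems(2) 0 by (cases k) (auto intro: supported_belowD)
    qed
    then have "\<epsilon> (u 0) = D.homology_class (f u)"
      using f_bottom um 0 by simp
    also have "\<dots> = boundaries D dD"
      using D.class_eq_boundaries_iff Suc.prems by (simp add: f.hom_closed)
    finally show ?thesis using um exact_0 0 by simp
  next
    case (Suc l)
    then have "\<delta> m (u m) = d u l"
      using Suc.prems d_top[of u l] by simp
    also have "\<dots> = \<zero>\<^bsub>F l\<^esub>"
      using Suc.prems by (simp add: direct_sum_simps)
    finally show ?thesis using um exact_Suc Suc by simp
  qed
  then obtain v where v: "v \<in> carrier (F (Suc m))" "u m = \<delta> (Suc m) v" by auto
  define w where "w = inclusion F (Suc m) v"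
  have w: "w \<in> carrier S" "supported_below (Suc (Suc m)) w" "w (Suc m) = v"
    using v by (simp_all add: w_def inclusion_closed supported_below_inclusion)
  define u' where "u' = u \<ominus>\<^bsub>S\<^esub> d w"
  have u': "u' \<in> carrier S"
    using Suc.prems w by (simp add: u'_def d.hom_closed)
  have "supported_below m u'"
    unfolding supported_below_def
  proof (intro allI impI)
    fix k assume "m \<le> k"
    have "d w m = u m"
      using d_top[OF w(1) _ w(2)] Suc.prems w v by simp
    then have "d w k = u k"
      using \<open>m \<le> k\<close> supported_belowD[OF d_lowers[OF w(1,2)]] supported_belowD[OF Suc.prems(2)]
      by (cases "k = m") simp_all
    then show "u' k = \<zero>\<^bsub>F k\<^esub>"
      using Suc.prems w apply_closed by (simp add: u'_def minus_apply F.M.r_neg F.M.minus_eq)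
  qed
  moreover have "d u' = \<zero>\<^bsub>S\<^esub>"
    using Suc.prems w d_d by (simp add: u'_def S.M.minus_eq)
  moreover have "f u' \<in> boundaries D dD"
  proof -
    have "f u' = f u \<ominus>\<^bsub>D\<^esub> dD (f w)"
      using Suc.prems w by (simp add: u'_def S.M.minus_eq D.M.minus_eq f_d)
    moreover have "dD (f w) \<in> boundaries D dD"
      using w by (simp add: boundaries_def f.hom_closed)
    ultimately show ?thesis
      using Suc.prems(5) by (simp add: D.M.minus_eq)
  qed
  ultimately obtain w' where w': "w' \<in> carrier S" "supported_below (Suc m) w'" "d w' = u'"
    using Suc.IH[OF u'] Suc.prems(3) by auto
  have "d (w' \<oplus>\<^bsub>S\<^esub> w) = u"
    using w w' Suc.prems S.M.minus_cancel_right by (simp add: u'_def)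
  then show ?case
    using w w' supported_below_add supported_below_mono[OF w'(2)]
    by (intro bexI[of _ "w' \<oplus>\<^bsub>S\<^esub> w"]) auto
qed

lemma d_inclusion_0: "x \<in> carrier (F 0) \<Longrightarrow> d (inclusion F 0 x) = \<zero>\<^bsub>S\<^esub>"
  using d_lowers[OF inclusion_closed[of x 0] supported_below_inclusion] by (simp add: supported_below_0_iff)

text \<open>
  The summand \<open>F 0\<close> consists of cycles, and surjectivity of \<open>\<epsilon>\<close> says that they represent all of the
  homology of \<open>D\<close>. Subtracting such a representative corrects the class of \<open>f\<close> on a cycle without
  destroying that it is a cycle.
\<close>

lemma homology_from_bottom:
  assumes "z \<in> carrier D" "dD z = \<zero>\<^bsub>D\<^esub>"
  obtains t where "t \<in> carrier (F 0)" "z \<ominus>\<^bsub>D\<^esub> f (inclusion F 0 t) \<in> boundaries D dD"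
proof -
  have "D.homology_class z \<in> \<epsilon> ` carrier (F 0)"
    unfolding \<epsilon>_surj D.homology_carrier using assms by blast
  then obtain t where "t \<in> carrier (F 0)" "D.homology_class z = \<epsilon> t" by blast
  then show thesis
    using that[of t] f_bottom D.class_eq_iff assms by (simp add: inclusion_closed f.hom_closed)
qed

text \<open>
  The cycle is \<open>z - w - t\<close>: the correction \<open>w\<close> makes it a cycle, the correction \<open>t\<close> in \<open>F 0\<close> makes
  its image bound. Both live below \<open>F n\<close> and leave the leading term \<open>z\<close> unchanged.
\<close>

lemma cycle_lifting:
  assumes "z \<in> \<delta> (Suc n) ` carrier (F (Suc n))"
  obtains u where "u \<in> carrier S" "supported_below (Suc n) u" "u n = z" "d u = \<zero>\<^bsub>S\<^esub>"
    "f u \<in> boundaries D dD"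
proof (cases n)
  case 0
  then have z: "z \<in> carrier (F 0)" "\<epsilon> z = boundaries D dD"
    using assms exact_0 by auto
  have "f (inclusion F 0 z) \<in> boundaries D dD"
    using f_bottom[OF z(1)] z D.class_eq_boundaries_iff[OF f.hom_closed[OF inclusion_closed[OF z(1)]]]
    by simp
  then show thesis
    using that[of "inclusion F 0 z"] z 0 d_inclusion_0
    by (simp add: inclusion_closed supported_below_inclusion)
next
  case (Suc m)
  then have z: "z \<in> carrier (F n)" "\<delta> n z = \<zero>\<^bsub>F m\<^esub>"
    using assms exact_Suc[of m] by auto
  define x where "x = inclusion F n z"
  have x: "x \<in> carrier S" "supported_below (Suc n) x" "x n = z"
    using z by (simp_all add: x_def inclusion_closed supported_below_inclusion)
  have "supported_below m (d x)"
    unfolding supported_below_def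
  proof (intro allI impI)
    fix k assume "m \<le> k"
    show "d x k = \<zero>\<^bsub>F k\<^esub>"
    proof (cases "k = m")
      case True
      then show ?thesis using d_top[OF x(1), of m] x z Suc by simp
    next
      case False
      then show ?thesis
        using supported_belowD[OF d_lowers[OF x(1,2)]] \<open>m \<le> k\<close> Suc by simp
    qed
  qed
  moreover have "f (d x) \<in> boundaries D dD"
    using x by (simp add: f_d boundaries_def f.hom_closed)
  ultimately obtain w where w: "w \<in> carrier S" "supported_below (Suc m) w" "d w = d x"
    using bounds_if_image_bounds[of "d x" m] x d_d Suc d.hom_closed by auto
  define v where "v = x \<ominus>\<^bsub>S\<^esub> w"
  have v: "v \<in> carrier S" "d v = \<zero>\<^bsub>S\<^esub>"
    using x w by (simp_all add: v_def S.M.minus_eq S.M.r_neg d.hom_closed)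
  obtain t where t: "t \<in> carrier (F 0)" "f v \<ominus>\<^bsub>D\<^esub> f (inclusion F 0 t) \<in> boundaries D dD"
    using homology_from_bottom[of "f v"] v f_d[OF v(1)] by (auto simp: f.hom_closed)
  define u where "u = v \<ominus>\<^bsub>S\<^esub> inclusion F 0 t"
  have i: "inclusion F 0 t \<in> carrier S" "d (inclusion F 0 t) = \<zero>\<^bsub>S\<^esub>"
    using t by (simp_all add: inclusion_closed d_inclusion_0)
  have u_apply: "u k = x k" if "n \<le> k" for k
    using that Suc x w i supported_belowD[OF w(2)] v(1)
    by (simp add: u_def v_def minus_apply F.M.diff_zero apply_closed)
  show thesis
  proof (rule that)
    show "u \<in> carrier S"
      using v i by (simp add: u_def)
    show "supported_below (Suc n) u"
      using x(2) u_apply by (simp add: supported_below_def)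
    show "u n = z"
      using u_apply[of n] x by simp
    show "d u = \<zero>\<^bsub>S\<^esub>"
      using v i by (simp add: u_def S.M.minus_eq)
    show "f u \<in> boundaries D dD"
      using v i t by (simp add: u_def S.M.minus_eq D.M.minus_eq)
  qed
qed

text \<open>
  All equations satisfied by a lifting are preserved when \<open>u\<close> and \<open>y\<close> are replaced by their
  components of the right degrees, since \<open>d\<close>, \<open>f\<close> and \<open>dD\<close> commute with taking components.
\<close>

lemma homogeneous_cycle_lifting:
  assumes b: "b \<in> grade (F (Suc n)) j"
  obtains u y where "u \<in> grade S (a + j)" "y \<in> grade D j" "supported_below (Suc n) u"
    "u n = \<delta> (Suc n) b" "d u = \<zero>\<^bsub>S\<^esub>" "f u = dD y"
proof -
  obtain u where u: "u \<in> carrier S" "supported_below (Suc n) u" "u n = \<delta> (Suc n) b" "d u = \<zero>\<^bsub>S\<^esub>"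
    "f u \<in> boundaries D dD"
    using cycle_lifting[of "\<delta> (Suc n) b"] F.summand_closed[OF b] by blast
  then obtain y where y: "y \<in> carrier D" "f u = dD y"
    by (auto simp: boundaries_def)
  have part_apply: "homogeneous_part S k x i = homogeneous_part (F i) k (x i)" if "x \<in> carrier S" for x k i
    using homogeneous_part_hom_commute[OF S.graded_module_axioms summand, of i 0 "\<lambda>x. x i" x k] that
      apply_graded_hom by simp
  show thesis
  proof (rule that)
    show "homogeneous_part S (a + j) u \<in> grade S (a + j)"
      using u by (intro S.component_decomposition(1))
    show "homogeneous_part D j y \<in> grade D j"
      using y by (intro D.component_decomposition(1))
    show "supported_below (Suc n) (homogeneous_part S (a + j) u)"
      using u by (simp add: supported_below_def part_apply F.component_zero)
    have "\<delta> (Suc n) b \<in> grade (F n) (a + j)"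
      using graded_homD(4)[OF \<delta>_hom b] by simp
    then show "homogeneous_part S (a + j) u n = \<delta> (Suc n) b"
      using u by (simp add: part_apply F.component_of_summand)
    have "homogeneous_part S (a + (a + j)) (d u) = d (homogeneous_part S (a + j) u)"
      by (rule homogeneous_part_hom_commute[OF S.graded_module_axioms S.graded_module_axioms d_hom u(1)])
    then show "d (homogeneous_part S (a + j) u) = \<zero>\<^bsub>S\<^esub>"
      using u by (simp add: S.component_zero)
    have "f (homogeneous_part S (a + j) u) = homogeneous_part D (a + j) (f u)"
      using homogeneous_part_hom_commute[OF S.graded_module_axioms D.graded_module_axioms, of 0 f u "a + j"]
        f_hom u by simp
    also have "\<dots> = dD (homogeneous_part D j y)"
      using homogeneous_part_hom_commute[OF D.graded_module_axioms D.graded_module_axioms D.d_hom y(1)] y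
      by simp
    finally show "f (homogeneous_part S (a + j) u) = dD (homogeneous_part D j y)" .
  qed
qed

end

section \<open>Adding one summand\<close>

text \<open>
  In a stage of the construction both maps are zero on the summands beyond \<open>F n\<close>, which leaves
  their values there free to be chosen.
\<close>

locale flag_stage = flag_up_to +
  assumes d_bounded: "x \<in> carrier S \<Longrightarrow> supported_below n (d x)"
    and d_f_vanish: "\<lbrakk>x \<in> carrier S; \<And>k. k \<le> n \<Longrightarrow> x k = \<zero>\<^bsub>F k\<^esub>\<rbrakk> \<Longrightarrow> d x = \<zero>\<^bsub>S\<^esub> \<and> f x = \<zero>\<^bsub>D\<^esub>"

context homology_resolution
begin

lemma \<epsilon>_zero: "\<epsilon> \<zero>\<^bsub>F 0\<^esub> = boundaries D dD"
proof -
  have "\<delta> (Suc 0) \<zero>\<^bsub>F (Suc 0)\<^esub> = \<zero>\<^bsub>F 0\<^esub>"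
    by (rule abelian_group_hom.hom_zero[OF \<delta>_abelian_hom])
  then have "\<zero>\<^bsub>F 0\<^esub> \<in> \<delta> (Suc 0) ` carrier (F (Suc 0))"
    using imageI[OF F.M.zero_closed, of "\<delta> (Suc 0)" "Suc 0"] by simp
  then show ?thesis
    unfolding exact_0 by simp
qed

lemma flag_stage_0: "\<exists>d f. flag_stage R F D a dD \<delta> \<epsilon> 0 d f"
proof -
  obtain B where B: "homogeneous_basis R (F 0) B"
    using free[of 0] by (auto simp: graded_free_def)
  interpret B: based_module R "F 0" B
    by unfold_locales (rule B)
  have "\<exists>z. (\<forall>j. b \<in> grade (F 0) j \<longrightarrow> z \<in> grade D j) \<and>
      (z \<in> carrier D \<and> dD z = \<zero>\<^bsub>D\<^esub> \<and> \<epsilon> b = D.homology_class z)" if bB: "b \<in> B" for b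
  proof (cases "b = \<zero>\<^bsub>F 0\<^esub>")
    \<comment> \<open>zero belongs to every degree, any other basis element to exactly one\<close>
    case True
    then show ?thesis
      using D.class_eq_boundaries_iff[OF D.M.zero_closed]
      by (intro exI[of _ "\<zero>\<^bsub>D\<^esub>"]) (simp add: D.zero_in_summand \<epsilon>_zero)
  next
    case False
    obtain j where j: "b \<in> grade (F 0) j" using B.basis_homogeneous[OF bB] by blast
    have "\<epsilon> b \<in> D.homology_class ` {z \<in> grade D j. dD z = \<zero>\<^bsub>D\<^esub>}"
      using graded_homD(4)[OF \<epsilon>_hom j] by (simp add: D.homology_grade)
    then obtain z where z: "z \<in> grade D j" "dD z = \<zero>\<^bsub>D\<^esub>" "\<epsilon> b = D.homology_class z" by blast
    moreover have "i = j" if "b \<in> grade (F 0) i" for i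
      using F.grade_unique[OF False that j] .
    ultimately show ?thesis
      using D.summand_closed by blast
  qed
  then obtain g where g: "\<And>b j. \<lbrakk>b \<in> B; b \<in> grade (F 0) j\<rbrakk> \<Longrightarrow> g b \<in> grade D j"
    and g_cycle: "\<And>b. b \<in> B \<Longrightarrow> g b \<in> carrier D \<and> dD (g b) = \<zero>\<^bsub>D\<^esub> \<and> \<epsilon> b = D.homology_class (g b)"
    by metis
  obtain h where h_hom: "graded_hom R (F 0) D h" and h_basis: "\<And>b. b \<in> B \<Longrightarrow> h b = g b"
    using B.extend_from_basis[OF graded_scalars D.graded_module_axioms, of g 0] g by auto
  interpret h: abelian_group_hom "F 0" D h
    using h_hom by (intro graded_hom_abelian[where a = 0] F.M.abelian_group_axioms D.M.abelian_group_axioms) simp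
  have h_smult: "h (r \<odot>\<^bsub>F 0\<^esub> x) = r \<odot>\<^bsub>D\<^esub> h x" if "r \<in> carrier R" "x \<in> carrier (F 0)" for r x
    using graded_homD(3)[OF h_hom that] .
  have \<epsilon>_add: "\<epsilon> (x \<oplus>\<^bsub>F 0\<^esub> y) = \<epsilon> x \<oplus>\<^bsub>homology D dD\<^esub> \<epsilon> y" if "x \<in> carrier (F 0)" "y \<in> carrier (F 0)" for x y
    using graded_homD(2)[OF \<epsilon>_hom that] .
  have \<epsilon>_smult: "\<epsilon> (r \<odot>\<^bsub>F 0\<^esub> x) = r \<odot>\<^bsub>homology D dD\<^esub> \<epsilon> x" if "r \<in> carrier R" "x \<in> carrier (F 0)" for r x
    using graded_homD(3)[OF \<epsilon>_hom that] .
  have h_props: "dD (h x) = \<zero>\<^bsub>D\<^esub> \<and> \<epsilon> x = D.homology_class (h x)" if "x \<in> carrier (F 0)" for x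
    using that
  proof (induction rule: B.basis_induct)
    case zero
    show ?case using D.class_eq_boundaries_iff[OF D.M.zero_closed] by (simp add: \<epsilon>_zero)
  next
    case (add x y)
    then show ?case by (simp add: \<epsilon>_add D.homology_add h.hom_closed)
  next
    case (smult r x)
    then show ?case by (simp add: \<epsilon>_smult h_smult D.homology_smult D.d_smult h.hom_closed)
  next
    case (basis b)
    then show ?case using g_cycle h_basis by simp
  qed
  have "flag_stage R F D a dD \<delta> \<epsilon> 0 (\<lambda>x. \<zero>\<^bsub>S\<^esub>) (\<lambda>x. h (x 0))"
  proof unfold_locales
    show "graded_hom R S (twist S a) (\<lambda>x. \<zero>\<^bsub>S\<^esub>)"
      by (rule graded_hom_zero[OF S.graded_module_axioms])
    show "graded_hom R S D (\<lambda>x. h (x 0))"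
      using graded_hom_comp[of R S "F 0" 0 "\<lambda>x. x 0" D 0 h] apply_graded_hom h_hom by simp
    show "h (\<zero>\<^bsub>S\<^esub> 0) = dD (h (x 0))" if "x \<in> carrier S" for x
      using h_props[OF apply_closed[OF that]] by (simp add: direct_sum_simps)
  qed (auto simp: supported_below_zero h_props)
  then show ?thesis by blast
qed

end

context flag_stage
begin

text \<open>
  The old maps vanish on \<open>F (Suc n)\<close>, so the new ones arise by adding maps \<open>U\<close> and \<open>Y\<close> that depend on
  the component in \<open>F (Suc n)\<close> only. The values of \<open>U\<close> are supported on \<open>F 0 \<oplus> \<dots> \<oplus> F n\<close>, where the
  new maps agree with the old ones; hence \<open>d' (d' x) = 0\<close> and \<open>f' (d' x) = dD (f' x)\<close> reduce to
  \<open>d (U x) = 0\<close> and \<open>f (U x) = dD (Y x)\<close>, which hold by the choice on the basis.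
\<close>

lemma next_stage:
  "\<exists>d' f'. flag_stage R F D a dD \<delta> \<epsilon> (Suc n) d' f' \<and>
    (\<forall>x\<in>carrier S. supported_below (Suc n) x \<longrightarrow> d' x = d x \<and> f' x = f x)"
proof -
  let ?F = "F (Suc n)"
  obtain B where B: "homogeneous_basis R ?F B"
    using free[of "Suc n"] by (auto simp: graded_free_def)
  interpret B: based_module R ?F B
    by unfold_locales (rule B)
  interpret \<delta>: abelian_group_hom ?F "F n" "\<delta> (Suc n)"
    by (rule \<delta>_abelian_hom)
  have "\<exists>u y. (\<forall>j. b \<in> grade ?F j \<longrightarrow> u \<in> grade S (a + j) \<and> y \<in> grade D j) \<and>
      supported_below (Suc n) u \<and> u n = \<delta> (Suc n) b \<and> d u = \<zero>\<^bsub>S\<^esub> \<and> f u = dD y" if bB: "b \<in> B" for b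
  proof (cases "b = \<zero>\<^bsub>?F\<^esub>")
    case True
    then show ?thesis
      by (intro exI[of _ "\<zero>\<^bsub>S\<^esub>"] exI[of _ "\<zero>\<^bsub>D\<^esub>"])
        (auto simp: S.zero_in_summand D.zero_in_summand supported_below_zero, simp add: direct_sum_simps)
  next
    case False
    obtain j where j: "b \<in> grade ?F j" using B.basis_homogeneous[OF bB] by blast
    obtain u y where "u \<in> grade S (a + j)" "y \<in> grade D j" "supported_below (Suc n) u"
        "u n = \<delta> (Suc n) b" "d u = \<zero>\<^bsub>S\<^esub>" "f u = dD y"
      using homogeneous_cycle_lifting[OF j] .
    moreover have "i = j" if "b \<in> grade ?F i" for i
      using F.grade_unique[OF False that j] .
    ultimately show ?thesis by blast
  qed
  then obtain u y where
      uy: "\<And>b j. \<lbrakk>b \<in> B; b \<in> grade ?F j\<rbrakk> \<Longrightarrow> u b \<in> grade S (a + j) \<and> y b \<in> grade D j"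
    and uy': "\<And>b. b \<in> B \<Longrightarrow> supported_below (Suc n) (u b) \<and> u b n = \<delta> (Suc n) b \<and>
        d (u b) = \<zero>\<^bsub>S\<^esub> \<and> f (u b) = dD (y b)"
    by metis
  obtain U where U_hom: "graded_hom R ?F (twist S a) U" and U_basis: "\<And>b. b \<in> B \<Longrightarrow> U b = u b"
    using B.extend_from_basis[OF graded_scalars S.graded_module_axioms, of u a] uy by auto
  obtain Y where Y_hom: "graded_hom R ?F D Y" and Y_basis: "\<And>b. b \<in> B \<Longrightarrow> Y b = y b"
    using B.extend_from_basis[OF graded_scalars D.graded_module_axioms, of y 0] uy by auto
  interpret U: abelian_group_hom ?F S U
    by (rule graded_hom_abelian[OF F.M.abelian_group_axioms S.M.abelian_group_axioms U_hom])
  interpret Y: abelian_group_hom ?F D Y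
    using Y_hom by (intro graded_hom_abelian[where a = 0] F.M.abelian_group_axioms D.M.abelian_group_axioms) simp
  have U_smult: "U (r \<odot>\<^bsub>?F\<^esub> x) = r \<odot>\<^bsub>S\<^esub> U x" if "r \<in> carrier R" "x \<in> carrier ?F" for r x
    using graded_homD(3)[OF U_hom that] by simp
  have Y_smult: "Y (r \<odot>\<^bsub>?F\<^esub> x) = r \<odot>\<^bsub>D\<^esub> Y x" if "r \<in> carrier R" "x \<in> carrier ?F" for r x
    using graded_homD(3)[OF Y_hom that] .
  have d_smult: "d (r \<odot>\<^bsub>S\<^esub> x) = r \<odot>\<^bsub>S\<^esub> d x" if "r \<in> carrier R" "x \<in> carrier S" for r x
    using graded_homD(3)[OF d_hom that] by simp
  have f_smult: "f (r \<odot>\<^bsub>S\<^esub> x) = r \<odot>\<^bsub>D\<^esub> f x" if "r \<in> carrier R" "x \<in> carrier S" for r x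
    using graded_homD(3)[OF f_hom that] .
  have UY: "supported_below (Suc n) (U x) \<and> U x n = \<delta> (Suc n) x \<and> d (U x) = \<zero>\<^bsub>S\<^esub> \<and> f (U x) = dD (Y x)"
    if "x \<in> carrier ?F" for x
    using that
  proof (induction rule: B.basis_induct)
    case zero
    show ?case by (simp add: supported_below_zero) (simp add: direct_sum_simps)
  next
    case (add x y)
    then have "(U x \<oplus>\<^bsub>S\<^esub> U y) n = U x n \<oplus>\<^bsub>F n\<^esub> U y n" by (simp add: direct_sum_simps)
    with add show ?case by (simp add: supported_below_add U.hom_closed Y.hom_closed)
  next
    case (smult r x)
    then have "(r \<odot>\<^bsub>S\<^esub> U x) n = r \<odot>\<^bsub>F n\<^esub> U x n" by (simp add: direct_sum_simps)
    with smult show ?case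
      by (simp add: supported_below_smult U.hom_closed Y.hom_closed U_smult Y_smult d_smult f_smult
          \<delta>_smult D.d_smult)
  next
    case (basis b)
    then show ?case using uy' U_basis Y_basis by simp
  qed
  define d' where "d' x = d x \<oplus>\<^bsub>S\<^esub> U (x (Suc n))" for x
  define f' where "f' x = f x \<oplus>\<^bsub>D\<^esub> Y (x (Suc n))" for x
  have agree: "d' x = d x" "f' x = f x" if "x \<in> carrier S" "x (Suc n) = \<zero>\<^bsub>?F\<^esub>" for x
    using that by (simp_all add: d'_def f'_def d.hom_closed f.hom_closed)
  have d'_apply: "d' x k = d x k \<oplus>\<^bsub>F k\<^esub> U (x (Suc n)) k" for x k
    by (simp add: d'_def direct_sum_simps)
  have d'_bounded: "supported_below (Suc n) (d' x)" if x: "x \<in> carrier S" for x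
    unfolding d'_def
    using UY[OF apply_closed[OF x]] supported_below_mono[OF d_bounded[OF x]]
    by (intro supported_below_add) auto
  have d'_hom: "graded_hom R S (twist S a) d'"
    unfolding d'_def
    using graded_hom_add[OF S.graded_module_axioms d_hom, of "\<lambda>x. U (x (Suc n))"]
      graded_hom_comp[of R S ?F 0 "\<lambda>x. x (Suc n)" S a U] apply_graded_hom U_hom by simp
  have f'_hom: "graded_hom R S D f'"
    unfolding f'_def
    using graded_hom_add[OF D.graded_module_axioms, of S 0 f "\<lambda>x. Y (x (Suc n))"] f_hom
      graded_hom_comp[of R S ?F 0 "\<lambda>x. x (Suc n)" D 0 Y] apply_graded_hom Y_hom by simp
  have d'_closed: "d' x \<in> carrier S" if "x \<in> carrier S" for x
    using graded_homD(1)[OF d'_hom that] by simp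
  have "flag_stage R F D a dD \<delta> \<epsilon> (Suc n) d' f'"
  proof unfold_locales
    fix x assume x: "x \<in> carrier S"
    note xn = apply_closed[OF x, of "Suc n"]
    have d'x: "(d' x) (Suc n) = \<zero>\<^bsub>?F\<^esub>"
      using supported_belowD[OF d'_bounded[OF x]] by simp
    show "d' (d' x) = \<zero>\<^bsub>S\<^esub>"
      unfolding agree(1)[OF d'_closed[OF x] d'x]
      using UY[OF xn] d_d[OF x] x xn by (simp add: d'_def d.hom_closed U.hom_closed)
    show "f' (d' x) = dD (f' x)"
      unfolding agree(2)[OF d'_closed[OF x] d'x]
      using UY[OF xn] f_d[OF x] x xn
      by (simp add: d'_def f'_def d.hom_closed U.hom_closed f.hom_closed Y.hom_closed)
    show "supported_below (Suc n) (d' x)"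
      by (rule d'_bounded[OF x])
    show "d' x = \<zero>\<^bsub>S\<^esub> \<and> f' x = \<zero>\<^bsub>D\<^esub>" if "\<And>k. k \<le> Suc n \<Longrightarrow> x k = \<zero>\<^bsub>F k\<^esub>"
      using d_f_vanish[OF x] that agree[OF x] by simp
    fix m
    show "supported_below m (d' x)" if m: "supported_below (Suc m) x"
    proof (cases "m \<le> n")
      case True
      then have "x (Suc n) = \<zero>\<^bsub>?F\<^esub>" using m by (auto intro: supported_belowD)
      then show ?thesis using agree[OF x] d_lowers[OF x m] by simp
    next
      case False
      then show ?thesis using supported_below_mono[OF d'_bounded[OF x]] by simp
    qed
    show "d' x m = \<delta> (Suc m) (x (Suc m))" if m: "m < Suc n" "supported_below (Suc (Suc m)) x"
    proof (cases "m = n")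
      case True
      have "d x n = \<zero>\<^bsub>F n\<^esub>" using supported_belowD[OF d_bounded[OF x]] by simp
      then show ?thesis
        using True UY[OF xn] xn by (simp add: d'_apply \<delta>.hom_closed)
    next
      case False
      then have "x (Suc n) = \<zero>\<^bsub>?F\<^esub>" using m by (auto intro: supported_belowD)
      then show ?thesis using agree[OF x] d_top[OF x] m False by simp
    qed
  next
    fix t assume t: "t \<in> carrier (F 0)"
    show "\<epsilon> t = D.homology_class (f' (inclusion F 0 t))"
      using f_bottom[OF t] agree(2)[OF inclusion_closed[OF t]] by simp
  qed (rule d'_hom f'_hom)+
  moreover have "\<forall>x\<in>carrier S. supported_below (Suc n) x \<longrightarrow> d' x = d x \<and> f' x = f x"
    using agree by (auto intro: supported_belowD)
  ultimately show ?thesis by blast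
qed

end

section \<open>The limit flag and its quasi-isomorphism\<close>

context homology_resolution
begin

text \<open>
  Consecutive stages agree on the summands already treated, so on each element, which has finite
  support, the sequence of stages is eventually constant. Every identity involves finitely many
  elements and is inherited from one sufficiently late stage.
\<close>

lemma flag_exists: "\<exists>d f. \<forall>n. flag_up_to R F D a dD \<delta> \<epsilon> n d f"
proof -
  define P where "P n p \<longleftrightarrow> flag_stage R F D a dD \<delta> \<epsilon> n (fst p) (snd p)" for n p
  define Q where "Q n p q \<longleftrightarrow> (\<forall>x\<in>carrier S. supported_below (Suc n) x \<longrightarrow>
      fst q x = fst p x \<and> snd q x = snd p x)"
    for n and p q :: "((nat \<Rightarrow> 'f) \<Rightarrow> (nat \<Rightarrow> 'f)) \<times> ((nat \<Rightarrow> 'f) \<Rightarrow> 'd)"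
  have "\<exists>p. \<forall>n. P n (p n) \<and> Q n (p n) (p (Suc n))"
  proof (rule dependent_nat_choice)
    show "\<exists>p. P 0 p"
      using flag_stage_0 by (auto simp: P_def)
    show "\<exists>q. P (Suc n) q \<and> Q n p q" if "P n p" for p n
      using flag_stage.next_stage[OF that[unfolded P_def]] by (force simp: P_def Q_def)
  qed
  then obtain p where p: "\<And>n. P n (p n)" "\<And>n. Q n (p n) (p (Suc n))" by blast
  define ds fs where "ds n = fst (p n)" and "fs n = snd (p n)" for n
  have stage: "flag_stage R F D a dD \<delta> \<epsilon> n (ds n) (fs n)" for n
    using p(1) by (simp add: P_def ds_def fs_def)
  interpret st: flag_stage R F D a dD \<delta> \<epsilon> n "ds n" "fs n" for n
    by (rule stage)
  have stable: "ds m x = ds n x \<and> fs m x = fs n x"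
    if "n \<le> m" and x: "x \<in> carrier S" "supported_below (Suc n) x" for m n x
    using that(1)
  proof (induction m rule: dec_induct)
    case (step m)
    then show ?case
      using p(2)[of m] x supported_below_mono[OF x(2), of "Suc m"] by (simp add: Q_def ds_def fs_def)
  qed simp
  \<comment> \<open>the earliest stage that determines the values on \<open>x\<close>\<close>
  define level where "level x = (LEAST n. supported_below (Suc n) x)" for x
  define d f where "d x = ds (level x) x" and "f x = fs (level x) x" for x
  have limit: "d x = ds n x" "f x = fs n x" if x: "x \<in> carrier S" "supported_below (Suc n) x" for x n
  proof -
    have "supported_below (Suc (level x)) x" "level x \<le> n"
      unfolding level_def using x(2) by (auto intro: LeastI Least_le)
    then show "d x = ds n x" "f x = fs n x"
      using stable[of "level x" n x] x by (simp_all add: d_def f_def)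
  qed
  have bound: "\<exists>n. supported_below (Suc n) x" if x: "x \<in> carrier S" for x
  proof -
    obtain n where "supported_below n x" using supported_below_exists[OF x] .
    then have "supported_below (Suc n) x" by (rule supported_below_mono) simp
    then show ?thesis ..
  qed
  have bound2: "\<exists>n. supported_below (Suc n) x \<and> supported_below (Suc n) y"
    if xy: "x \<in> carrier S" "y \<in> carrier S" for x y
  proof -
    obtain i j where "supported_below (Suc i) x" "supported_below (Suc j) y"
      using bound xy by blast
    then have "supported_below (Suc (max i j)) x" "supported_below (Suc (max i j)) y"
      by (auto elim: supported_below_mono)
    then show ?thesis by blast
  qed
  have homs: "graded_hom R S (twist S a) d" "graded_hom R S D f"
    unfolding graded_hom_def
  proof (safe)
    fix x assume x: "x \<in> carrier S"
    then obtain n where n: "supported_below (Suc n) x" using bound by blast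
    show "d x \<in> carrier (twist S a)" "f x \<in> carrier D"
      using x by (simp_all add: limit[OF x n] st.d.hom_closed st.f.hom_closed)
    fix r assume r: "r \<in> carrier R"
    show "d (r \<odot>\<^bsub>S\<^esub> x) = r \<odot>\<^bsub>twist S a\<^esub> d x" "f (r \<odot>\<^bsub>S\<^esub> x) = r \<odot>\<^bsub>D\<^esub> f x"
      using limit[OF S.smult_closed[OF r x] supported_below_smult[OF r n]]
        graded_homD(3)[OF st.d_hom r x] graded_homD(3)[OF st.f_hom r x] by (simp_all add: limit[OF x n])
  next
    fix x y assume x: "x \<in> carrier S" and y: "y \<in> carrier S"
    obtain n where n: "supported_below (Suc n) x" "supported_below (Suc n) y" using bound2[OF x y] by blast
    show "d (x \<oplus>\<^bsub>S\<^esub> y) = d x \<oplus>\<^bsub>twist S a\<^esub> d y" "f (x \<oplus>\<^bsub>S\<^esub> y) = f x \<oplus>\<^bsub>D\<^esub> f y"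
      using limit[OF S.M.a_closed[OF x y] supported_below_add[OF n]] x y
      by (simp_all add: limit[OF x n(1)] limit[OF y n(2)])
  next
    fix x j assume xj: "x \<in> grade S j"
    have x: "x \<in> carrier S" using S.summand_closed[OF xj] .
    then obtain n where n: "supported_below (Suc n) x" using bound by blast
    show "d x \<in> grade (twist S a) j" "f x \<in> grade D j"
      using graded_homD(4)[OF st.d_hom xj] graded_homD(4)[OF st.f_hom xj] by (simp_all add: limit[OF x n])
  qed
  have "flag_up_to R F D a dD \<delta> \<epsilon> n d f" for n
  proof unfold_locales
    fix x assume x: "x \<in> carrier S"
    then obtain i where i: "supported_below (Suc i) x" using bound by blast
    have "supported_below (Suc i) (ds i x)"
      by (rule supported_below_mono[OF st.d_lowers[OF x i]]) simp
    note li = limit[OF x i] limit[OF st.d.hom_closed[OF x] this]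
    show "d (d x) = \<zero>\<^bsub>S\<^esub>" "f (d x) = dD (f x)"
      using st.d_d[OF x] st.f_d[OF x] by (simp_all add: li)
    show "supported_below m (d x)" if "supported_below (Suc m) x" for m
      using st.d_lowers[OF x that] by (simp add: limit[OF x that])
    show "d x m = \<delta> (Suc m) (x (Suc m))" if "supported_below (Suc (Suc m)) x" for m
      using st.d_top[OF x _ that] by (simp add: limit[OF x that])
  next
    fix t assume t: "t \<in> carrier (F 0)"
    show "\<epsilon> t = D.homology_class (f (inclusion F 0 t))"
      using st.f_bottom[where n = 0, OF t] by (simp add: limit[OF inclusion_closed[OF t] supported_below_inclusion])
  qed (rule homs)+
  then show ?thesis by blast
qed

theorem free_flag_resolution_exists:
  "\<exists>d f. free_flag_resolution R a F d D dD f \<and>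
    (\<forall>i j. i \<le> j \<longrightarrow> (\<forall>x\<in>carrier (F i). block F d i j x = \<zero>\<^bsub>F j\<^esub>)) \<and>
    (\<forall>i. \<forall>x\<in>carrier (F (Suc i)). block F d (Suc i) i x = \<delta> (Suc i) x) \<and>
    (\<forall>i j. graded_hom R (F i) (twist (F j) a) (block F d i j))"
proof -
  obtain d f where df: "\<And>n. flag_up_to R F D a dD \<delta> \<epsilon> n d f"
    using flag_exists by blast
  interpret fl: flag_up_to R F D a dD \<delta> \<epsilon> n d f for n
    by (rule df)
  have upper: "block F d i j x = \<zero>\<^bsub>F j\<^esub>" if "i \<le> j" "x \<in> carrier (F i)" for i j x
    using supported_belowD[OF fl.d_lowers[OF inclusion_closed[OF that(2)] supported_below_inclusion] that(1)]
    by (simp add: block_def)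
  have diagonal: "block F d (Suc i) i x = \<delta> (Suc i) x" if "x \<in> carrier (F (Suc i))" for i x
    using fl.d_top[OF inclusion_closed[OF that] lessI supported_below_inclusion] by (simp add: block_def)
  have blocks: "graded_hom R (F i) (twist (F j) a) (block F d i j)" for i j
  proof -
    have "graded_hom R (F i) (twist S a) (\<lambda>x. d (inclusion F i x))"
      using graded_hom_comp[of R "F i" S 0 "inclusion F i" S a d] inclusion_hom fl.d_hom by simp
    then show ?thesis
      using graded_hom_comp[of R "F i" S a "\<lambda>x. d (inclusion F i x)" "F j" 0 "\<lambda>x. x j"] apply_graded_hom
      by (simp add: block_def[abs_def])
  qed
  have diff: "diff_module R a S d"
    using S.graded_module_axioms fl.d_hom fl.d_d by (simp add: diff_module_def)
  have "quasi_isomorphism R S d D dD f"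
  proof (rule quasi_isomorphismI)
    show "differential_module R S a d"
      using S.graded_module_axioms diff
      by (simp add: differential_module_def differential_module_axioms_def)
    show "\<exists>x\<in>carrier S. d x = \<zero>\<^bsub>S\<^esub> \<and> z \<ominus>\<^bsub>D\<^esub> f x \<in> boundaries D dD"
      if "z \<in> carrier D" "dD z = \<zero>\<^bsub>D\<^esub>" for z
      using fl.homology_from_bottom[OF that] inclusion_closed fl.d_inclusion_0 by metis
    show "x \<in> boundaries S d" if x: "x \<in> carrier S" "d x = \<zero>\<^bsub>S\<^esub>" "f x \<in> boundaries D dD" for x
    proof -
      obtain m where "supported_below m x" using supported_below_exists[OF x(1)] .
      then obtain w where "w \<in> carrier S" "d w = x"
        using fl.bounds_if_image_bounds[OF x(1) _ order_refl x(2,3)] by blast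
      then show ?thesis unfolding boundaries_def by blast
    qed
  qed (use fl.f_hom fl.f_d D.differential_module_axioms in auto)
  then show ?thesis
    using upper diagonal blocks diff free
    by (intro exI[of _ d] exI[of _ f]) (simp add: free_flag_resolution_def free_flag_def)
qed

end

text \<open>
  Twisting by multiples of \<open>a\<close> changes neither the underlying modules nor freeness, so a resolution
  of degree zero by the twisted modules yields exactness for the maps \<open>\<delta>\<close> of degree \<open>a\<close>.
\<close>

theorem theorem3p2:
  fixes R :: "'r gring" and a :: int
    and D :: "('r, 'd) gmodule" and dD :: "'d \<Rightarrow> 'd"
    and F :: "nat \<Rightarrow> ('r, 'f) gmodule" and \<delta> :: "nat \<Rightarrow> 'f \<Rightarrow> 'f" and \<epsilon> :: "'f \<Rightarrow> 'd set"
  assumes "graded_local_ring R"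
    and "diff_module R a D dD"
    and "finitely_generated R (homology D dD)"
    and "\<forall>i. graded_hom R (F (Suc i)) (twist (F i) a) (\<delta> (Suc i))"
    and "minimal_free_resolution R (homology D dD) (\<lambda>i. twist (F i) (- (int i * a))) \<delta> \<epsilon>"
  shows "\<exists>dF f. free_flag_resolution R a F dF D dD f \<and>
    (\<forall>i j. i \<le> j \<longrightarrow> (\<forall>x\<in>carrier (F i). block F dF i j x = \<zero>\<^bsub>F j\<^esub>)) \<and>
    (\<forall>i. \<forall>x\<in>carrier (F (Suc i)). block F dF (Suc i) i x = \<delta> (Suc i) x) \<and>
    (\<forall>i j. j + 1 < i \<longrightarrow> graded_hom R (F i) (twist (F j) a) (block F dF i j))"
proof -
  have res: "free_resolution R (homology D dD) (\<lambda>i. twist (F i) (- (int i * a))) \<delta> \<epsilon>"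
    using assms(5) by (simp add: minimal_free_resolution_def)
  have gr: "graded_ring R"
    using assms(1) by (simp add: graded_local_ring_def)
  have free: "graded_free R (F i)" for i
  proof -
    have "graded_free R (twist (F i) (- (int i * a)))"
      using res by (simp add: free_resolution_def)
    from graded_free_twist[OF this, of "int i * a"] show ?thesis by simp
  qed
  have "differential_module R D a dD"
    using assms(2) by (simp add: differential_module_def differential_module_axioms_def diff_module_def)
  moreover have "graded_family R F"
    using free gr by (simp add: graded_family_def graded_free_def)
  moreover have "homology_resolution_axioms R F D a dD \<delta> \<epsilon>"
    using free res assms(4)
    by (simp add: homology_resolution_axioms_def free_resolution_def a_kernel_def'
        differential_module.homology_zero[OF calculation(1)])
  ultimately have "homology_resolution R F D a dD \<delta> \<epsilon>"
    by (simp add: homology_resolution_def)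
  from homology_resolution.free_flag_resolution_exists[OF this] show ?thesis by blast
qed

end
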